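(* Let $1\leq r<q\leq\infty$ and let $\lambda,\mu,\nu,\alpha,\beta$ be real numbers. If $q<\infty$, then $H_{\lambda,\mu,\nu}$ is not bounded from $L^q_\alpha$ to $L^r_\beta$. If $q=\infty$, then $H_{\lambda,\mu,\nu}$ is not bounded from $L^\infty$ to $L^r_\beta$.
   Context: Let $p$ be a prime, $\mathbb{Q}_p$ the field of $p$-adic numbers with its norm $|\cdot|_p$ (so $|p|_p=p^{-1}$), $\mathbb{Q}_p^*=\mathbb{Q}_p\setminus\{0\}$, and $dx$ the Haar measure on $\mathbb{Q}_p$ normalized so that $\{x:|x|_p\leq 1\}$ has measure $1$. For $1\leq q<\infty$ and $\theta\in\mathbb{R}$, $L^q_\theta$ is the space of real-valued measurable functions $f$ on $\mathbb{Q}_p^*$ with $\|f\|_{q,\theta}=\left[\int_{\mathbb{Q}_p^*}|f(x)|^q|x|_p^\theta\,dx\right]^{1/q}<\infty$; $L^\infty$ is the space of real-valued measurable functions on $\mathbb{Q}_p^*$ with finite essential supremum norm $\|f\|_\infty$. For real $\lambda,\mu,\nu$ and a real-valued measurable $f$ on $\mathbb{Q}_p^*$, $$H_{\lambda,\mu,\nu}f(y)=\int_{\mathbb{Q}_p^*}\frac{|x|_p^\mu|y|_p^\nu}{[\max\{|x|_p,|y|_p\}]^\lambda}f(x)\,dx,\qquad y\in\mathbb{Q}_p^*.$$ "Bounded from $X$ to $Y$" means that for every $f\in X$ the integral converges absolutely for almost every $y$ and there is a constant $C$ with $\|H_{\lambda,\mu,\nu}f\|_Y\leq C\|f\|_X$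 for all $f\in X$. *)

theory Defs
  imports "HOL-Probability.Essential_Supremum" "Berlekamp_Zassenhaus.Finite_Field"
begin

section \<open>The \<open>p\<close>-adic absolute value on the rational numbers\<close>

definition padic_abs :: "nat \<Rightarrow> rat \<Rightarrow> real" where
  "padic_abs p x = (if x = 0 then 0 else
     real p powi (int (multiplicity (int p) (snd (quotient_of x)))
                - int (multiplicity (int p) (fst (quotient_of x)))))"

lemma padic_abs_0 [simp]: "padic_abs p 0 = 0"
  by (simp add: padic_abs_def)

context
  fixes p :: nat
  assumes p: "prime p"
begin

lemma padic_abs_frac:
  assumes "a \<noteq> 0" "b \<noteq> 0"
  shows "padic_abs p (of_int a / of_int b) =
    real p powi (int (multiplicity (int p) b) - int (multiplicity (int p) a))"
proof -
  have pe: "prime_elem (int p)" using p by auto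
  obtain c d where cd: "quotient_of (of_int a / of_int b) = (c, d)" by (cases "quotient_of (of_int a / of_int b)")
  have d: "d > 0" using quotient_of_denom_pos[OF cd] .
  have eq: "(of_int a / of_int b :: rat) = of_int c / of_int d" using quotient_of_div[OF cd] .
  have c: "c \<noteq> 0" using eq assms by auto
  have "(of_int (a * d) :: rat) = of_int (c * b)"
    using eq assms d by (simp add: field_simps)
  then have "a * d = c * b" by (simp only: of_int_eq_iff)
  then have "multiplicity (int p) (a * d) = multiplicity (int p) (c * b)" by simp
  then have "multiplicity (int p) a + multiplicity (int p) d = multiplicity (int p) c + multiplicity (int p) b"
    using assms c d by (simp add: prime_elem_multiplicity_mult_distrib[OF pe])
  then have "int (multiplicity (int p) d) - int (multiplicity (int p) c) = int (multiplicity (int p) b) - int (multiplicity (int p) a)"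
    by linarith
  then show ?thesis using assms cd by (simp add: padic_abs_def)
qed

lemma rat_frac_cases:
  fixes x :: rat
  obtains a b :: int where "b \<noteq> 0" "x = of_int a / of_int b"
  by (metis quotient_of_denom_pos quotient_of_div surj_pair less_irrefl)

lemma padic_abs_pos: "x \<noteq> 0 \<Longrightarrow> 0 < padic_abs p x"
  using p by (simp add: padic_abs_def prime_gt_0_nat)

lemma padic_abs_nonneg [simp]: "0 \<le> padic_abs p x"
  using padic_abs_pos[of x] by (cases "x = 0") auto

lemma padic_abs_eq_0_iff [simp]: "padic_abs p x = 0 \<longleftrightarrow> x = 0"
  using padic_abs_pos[of x] by (cases "x = 0") auto

lemma padic_abs_1 [simp]: "padic_abs p 1 = 1"
  using padic_abs_frac[of 1 1] by simp

lemma padic_abs_mult: "padic_abs p (x * y) = padic_abs p x * padic_abs p y"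
proof (cases "x = 0 \<or> y = 0")
  case False
  have pe: "prime_elem (int p)" using p by auto
  obtain a b where x: "b \<noteq> 0" "x = of_int a / of_int b" by (rule rat_frac_cases)
  obtain c d where y: "d \<noteq> 0" "y = of_int c / of_int d" by (rule rat_frac_cases)
  have ac: "a \<noteq> 0" "c \<noteq> 0" using False x y by auto
  have xy: "x * y = of_int (a * c) / of_int (b * d)" using x y by simp
  have p0: "real p \<noteq> 0" using p prime_gt_0_nat by auto
  have "b * d \<noteq> 0" "a * c \<noteq> 0" using x y ac by auto
  then have "padic_abs p (x * y) = real p powi
      (int (multiplicity (int p) (b * d)) - int (multiplicity (int p) (a * c)))"
    unfolding xy by (intro padic_abs_frac)
  also have "\<dots> = real p powi ((int (multiplicity (int p) b) - int (multiplicity (int p) a))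
      + (int (multiplicity (int p) d) - int (multiplicity (int p) c)))"
    using x(1) y(1) ac by (simp add: prime_elem_multiplicity_mult_distrib[OF pe] algebra_simps)
  also have "\<dots> = padic_abs p x * padic_abs p y"
    using p0 by (simp add: x(2) y(2) padic_abs_frac[OF ac(1) x(1)] padic_abs_frac[OF ac(2) y(1)] power_int_add)
  finally show ?thesis .
qed auto

lemma padic_abs_minus [simp]: "padic_abs p (- x) = padic_abs p x"
proof (cases "x = 0")
  case False
  obtain a b where x: "b \<noteq> 0" "x = of_int a / of_int b" by (rule rat_frac_cases)
  have "a \<noteq> 0" using False x by auto
  moreover have "- x = of_int (- a) / of_int b" using x by simp
  moreover have "multiplicity (int p) (- a) = multiplicity (int p) a"
    by (rule multiplicity_cong) simp
  ultimately show ?thesis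
    using padic_abs_frac[of "- a" b] padic_abs_frac[of a b] x by simp
qed auto

lemma padic_abs_minus_commute: "padic_abs p (x - y) = padic_abs p (y - x)"
  using padic_abs_minus[of "x - y"] by simp

lemma padic_abs_add: "padic_abs p (x + y) \<le> max (padic_abs p x) (padic_abs p y)"
proof (cases "x = 0 \<or> y = 0 \<or> x + y = 0")
  case True
  then show ?thesis by (auto simp: le_max_iff_disj)
next
  case False
  obtain a b where x: "b \<noteq> 0" "x = of_int a / of_int b" by (rule rat_frac_cases)
  obtain c d where y: "d \<noteq> 0" "y = of_int c / of_int d" by (rule rat_frac_cases)
  define m where "m = multiplicity (int p)"
  have x': "x = of_int (a * d) / of_int (b * d)" and y': "y = of_int (c * b) / of_int (b * d)"
    and xy': "x + y = of_int (a * d + c * b) / of_int (b * d)"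
    using x y by (simp_all add: field_simps)
  have nz: "b * d \<noteq> 0" "a * d \<noteq> 0" "c * b \<noteq> 0" "a * d + c * b \<noteq> 0"
  proof -
    show "b * d \<noteq> 0" using x y by simp
    show "a * d \<noteq> 0" using False x y by auto
    show "c * b \<noteq> 0" using False x y by auto
    show "a * d + c * b \<noteq> 0" using False xy' by (metis div_0 of_int_0)
  qed
  define k where "k = min (m (a * d)) (m (c * b))"
  have "int p ^ k dvd a * d" "int p ^ k dvd c * b"
    unfolding k_def m_def by (auto intro: multiplicity_dvd')
  then have "int p ^ k dvd a * d + c * b" by simp
  moreover have "\<not> is_unit (int p)" using p by auto
  ultimately have "k \<le> m (a * d + c * b)"
    unfolding m_def using nz(4) by (intro multiplicity_geI) auto
  then have "m (a * d) \<le> m (a * d + c * b) \<or> m (c * b) \<le> m (a * d + c * b)"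
    unfolding k_def by linarith
  moreover have "real p powi (int (m (b * d)) - int (m (a * d + c * b)))
       \<le> real p powi (int (m (b * d)) - int j)" if "j \<le> m (a * d + c * b)" for j
    using that p by (intro power_int_increasing) (auto dest: prime_ge_1_nat)
  ultimately show ?thesis
    unfolding le_max_iff_disj xy'
    using padic_abs_frac[OF nz(2,1)] padic_abs_frac[OF nz(3,1)] padic_abs_frac[OF nz(4,1)] x' y' m_def
    by metis
qed

lemma padic_abs_diff: "padic_abs p (x - y) \<le> max (padic_abs p x) (padic_abs p y)"
  using padic_abs_add[of x "- y"] by simp

lemma padic_abs_inverse: "padic_abs p (inverse x) = inverse (padic_abs p x)"
proof (cases "x = 0")
  case False
  then have "padic_abs p (inverse x) * padic_abs p x = 1"
    by (simp flip: padic_abs_mult)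
  then show ?thesis by (metis inverse_unique mult.commute)
qed auto

lemma padic_abs_diff_lipschitz: "\<bar>padic_abs p x - padic_abs p y\<bar> \<le> padic_abs p (x - y)"
proof -
  have "padic_abs p x \<le> max (padic_abs p (x - y)) (padic_abs p y)"
    using padic_abs_add[of "x - y" y] by simp
  moreover have "padic_abs p y \<le> max (padic_abs p (x - y)) (padic_abs p x)"
    using padic_abs_add[of "y - x" x] by (simp add: padic_abs_minus_commute)
  ultimately show ?thesis
    using padic_abs_nonneg[of x] padic_abs_nonneg[of y] padic_abs_nonneg[of "x - y"] by argo
qed

end


section \<open>The field \<open>\<rat>\<^sub>p\<close> as the completion of \<open>\<rat>\<close>\<close>

text \<open>
  The prime \<open>p\<close> is the cardinality of a type \<open>'p\<close> of class \<^class>\<open>prime_card\<close>, so that \<open>'p padic\<close>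
  is \<open>\<rat>\<^sub>p\<close> for \<open>p = CARD('p)\<close>.
\<close>

definition padic_vanishes :: "nat \<Rightarrow> (nat \<Rightarrow> rat) \<Rightarrow> bool" where
  "padic_vanishes p X \<longleftrightarrow> (\<forall>e>0. \<exists>N. \<forall>n\<ge>N. padic_abs p (X n) < e)"

definition padic_cauchy :: "nat \<Rightarrow> (nat \<Rightarrow> rat) \<Rightarrow> bool" where
  "padic_cauchy p X \<longleftrightarrow> (\<forall>e>0. \<exists>N. \<forall>m\<ge>N. \<forall>n\<ge>N. padic_abs p (X m - X n) < e)"

definition padic_rel :: "'p::prime_card itself \<Rightarrow> (nat \<Rightarrow> rat) \<Rightarrow> (nat \<Rightarrow> rat) \<Rightarrow> bool" where
  "padic_rel _ X Y \<longleftrightarrow> padic_cauchy CARD('p) X \<and> padic_cauchy CARD('p) Y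
     \<and> padic_vanishes CARD('p) (\<lambda>n. X n - Y n)"

context
  fixes p :: nat
  assumes p: "prime p"
begin

lemma padic_cauchy_const [simp]: "padic_cauchy p (\<lambda>n. c)"
  by (simp add: padic_cauchy_def)

lemma padic_vanishes_zero [simp]: "padic_vanishes p (\<lambda>n. 0)"
  by (simp add: padic_vanishes_def)

lemma padic_vanishes_const: "padic_vanishes p (\<lambda>n. c) \<longleftrightarrow> c = 0"
  using padic_abs_pos[OF p, of c] by (auto simp: padic_vanishes_def)

lemma padic_vanishes_add:
  assumes "padic_vanishes p X" "padic_vanishes p Y"
  shows "padic_vanishes p (\<lambda>n. X n + Y n)"
  unfolding padic_vanishes_def
proof (intro allI impI)
  fix e :: real assume "e > 0"
  then obtain N1 N2 where "\<forall>n\<ge>N1. padic_abs p (X n) < e" "\<forall>n\<ge>N2. padic_abs p (Y n) < e"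
    using assms unfolding padic_vanishes_def by meson
  then have "\<forall>n\<ge>max N1 N2. padic_abs p (X n + Y n) < e"
    using padic_abs_add[OF p] by (smt (verit, best) max.bounded_iff)
  then show "\<exists>N. \<forall>n\<ge>N. padic_abs p (X n + Y n) < e" by blast
qed

lemma padic_vanishes_minus: "padic_vanishes p (\<lambda>n. - X n) \<longleftrightarrow> padic_vanishes p X"
  by (simp add: padic_vanishes_def padic_abs_minus[OF p])

lemma padic_vanishes_diff:
  "padic_vanishes p X \<Longrightarrow> padic_vanishes p Y \<Longrightarrow> padic_vanishes p (\<lambda>n. X n - Y n)"
  using padic_vanishes_add[of X "\<lambda>n. - Y n"] by (simp add: padic_vanishes_minus)

lemma padic_cauchy_add:
  assumes "padic_cauchy p X" "padic_cauchy p Y"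
  shows "padic_cauchy p (\<lambda>n. X n + Y n)"
  unfolding padic_cauchy_def
proof (intro allI impI)
  fix e :: real assume "e > 0"
  then obtain N1 N2 where N: "\<forall>m\<ge>N1. \<forall>n\<ge>N1. padic_abs p (X m - X n) < e"
      "\<forall>m\<ge>N2. \<forall>n\<ge>N2. padic_abs p (Y m - Y n) < e"
    using assms unfolding padic_cauchy_def by meson
  have "padic_abs p ((X m + Y m) - (X n + Y n)) < e" if "m \<ge> max N1 N2" "n \<ge> max N1 N2" for m n
  proof -
    have "padic_abs p (X m - X n) < e" "padic_abs p (Y m - Y n) < e" using N that by auto
    moreover have "(X m + Y m) - (X n + Y n) = (X m - X n) + (Y m - Y n)" by simp
    ultimately show ?thesis using padic_abs_add[OF p, of "X m - X n" "Y m - Y n"]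
      by (metis max_less_iff_conj order_le_less_trans)
  qed
  then show "\<exists>N. \<forall>m\<ge>N. \<forall>n\<ge>N. padic_abs p ((X m + Y m) - (X n + Y n)) < e" by blast
qed

lemma padic_cauchy_minus: "padic_cauchy p X \<Longrightarrow> padic_cauchy p (\<lambda>n. - X n)"
  unfolding padic_cauchy_def
  by (metis (no_types, lifting) minus_diff_minus padic_abs_minus[OF p])

lemma padic_cauchy_diff:
  "padic_cauchy p X \<Longrightarrow> padic_cauchy p Y \<Longrightarrow> padic_cauchy p (\<lambda>n. X n - Y n)"
  using padic_cauchy_add[of X "\<lambda>n. - Y n"] padic_cauchy_minus[of Y] by simp

lemma padic_cauchy_bounded:
  assumes "padic_cauchy p X"
  obtains B where "B > 0" "\<And>n. padic_abs p (X n) < B"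
proof -
  obtain N where N: "\<forall>m\<ge>N. \<forall>n\<ge>N. padic_abs p (X m - X n) < 1"
    using assms unfolding padic_cauchy_def by (meson zero_less_one)
  define B where "B = (\<Sum>i\<le>N. padic_abs p (X i)) + 1"
  have le: "padic_abs p (X i) \<le> (\<Sum>i\<le>N. padic_abs p (X i))" if "i \<le> N" for i
    using that padic_abs_nonneg[OF p] by (intro member_le_sum) auto
  have "padic_abs p (X n) < B" for n
  proof (cases "n \<le> N")
    case True
    then show ?thesis using le[of n] by (simp add: B_def)
  next
    case False
    then have "padic_abs p (X n - X N) < 1" using N by auto
    moreover have "padic_abs p (X n) \<le> max (padic_abs p (X n - X N)) (padic_abs p (X N))"
      using padic_abs_add[OF p, of "X n - X N" "X N"] by simp
    ultimately show ?thesis using le[of N] padic_abs_nonneg[OF p, of "X N"] by (simp add: B_def)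
  qed
  moreover have "B > 0" using padic_abs_nonneg[OF p, of "X 0"] calculation[of 0] by linarith
  ultimately show ?thesis using that by blast
qed

lemma padic_vanishes_mult_bounded:
  assumes "padic_cauchy p X" "padic_vanishes p Y"
  shows "padic_vanishes p (\<lambda>n. X n * Y n)"
  unfolding padic_vanishes_def
proof (intro allI impI)
  fix e :: real assume "e > 0"
  obtain B where B: "B > 0" "\<And>n. padic_abs p (X n) < B" using padic_cauchy_bounded[OF assms(1)] by blast
  have "e / B > 0" using B \<open>e > 0\<close> by simp
  then obtain N where N: "\<forall>n\<ge>N. padic_abs p (Y n) < e / B"
    using assms(2) unfolding padic_vanishes_def by meson
  have "padic_abs p (X n * Y n) < e" if "n \<ge> N" for n
  proof -
    have "padic_abs p (X n * Y n) < B * (e / B)"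
      unfolding padic_abs_mult[OF p]
      using B N that padic_abs_nonneg[OF p] by (intro mult_strict_mono') auto
    then show ?thesis using B by simp
  qed
  then show "\<exists>N. \<forall>n\<ge>N. padic_abs p (X n * Y n) < e" by blast
qed

lemma padic_cauchy_mult:
  assumes "padic_cauchy p X" "padic_cauchy p Y"
  shows "padic_cauchy p (\<lambda>n. X n * Y n)"
  unfolding padic_cauchy_def
proof (intro allI impI)
  fix e :: real assume "e > 0"
  obtain A where A: "A > 0" "\<And>n. padic_abs p (X n) < A" using padic_cauchy_bounded[OF assms(1)] by blast
  obtain B where B: "B > 0" "\<And>n. padic_abs p (Y n) < B" using padic_cauchy_bounded[OF assms(2)] by blast
  have "e / A > 0" "e / B > 0" using A B \<open>e > 0\<close> by simp_all
  then obtain N1 N2 where N: "\<forall>m\<ge>N1. \<forall>n\<ge>N1. padic_abs p (X m - X n) < e / B"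
      "\<forall>m\<ge>N2. \<forall>n\<ge>N2. padic_abs p (Y m - Y n) < e / A"
    using assms unfolding padic_cauchy_def by meson
  have "padic_abs p (X m * Y m - X n * Y n) < e" if "m \<ge> max N1 N2" "n \<ge> max N1 N2" for m n
  proof -
    have "padic_abs p (X m * (Y m - Y n)) < A * (e / A)"
      unfolding padic_abs_mult[OF p]
      using A N that padic_abs_nonneg[OF p] by (intro mult_strict_mono') auto
    moreover have "padic_abs p ((X m - X n) * Y n) < (e / B) * B"
      unfolding padic_abs_mult[OF p]
      using B N that padic_abs_nonneg[OF p] by (intro mult_strict_mono') auto
    ultimately show ?thesis
      using padic_abs_add[OF p, of "X m * (Y m - Y n)" "(X m - X n) * Y n"] A B
      by (simp add: mult_diff_mult)
  qed
  then show "\<exists>N. \<forall>m\<ge>N. \<forall>n\<ge>N. padic_abs p (X m * Y m - X n * Y n) < e" by blast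
qed

lemma padic_cauchy_not_vanishes:
  assumes "padic_cauchy p X" "\<not> padic_vanishes p X"
  obtains b N where "b > 0" "\<And>n. n \<ge> N \<Longrightarrow> b \<le> padic_abs p (X n)"
proof -
  obtain e where e: "e > 0" "\<And>N. \<exists>n\<ge>N. padic_abs p (X n) \<ge> e"
    using assms(2) unfolding padic_vanishes_def by (meson linorder_not_less)
  obtain N where N: "\<forall>m\<ge>N. \<forall>n\<ge>N. padic_abs p (X m - X n) < e"
    using assms(1) e unfolding padic_cauchy_def by meson
  obtain k where k: "k \<ge> N" "padic_abs p (X k) \<ge> e" using e by blast
  have "e \<le> padic_abs p (X n)" if "n \<ge> N" for n
  proof -
    have "padic_abs p (X k - X n) < e" using N k that by blast
    moreover have "padic_abs p (X k) \<le> max (padic_abs p (X k - X n)) (padic_abs p (X n))"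
      using padic_abs_add[OF p, of "X k - X n" "X n"] by simp
    ultimately show ?thesis using k by linarith
  qed
  then show ?thesis using that e by blast
qed

lemma padic_abs_inverse_diff:
  assumes "b > 0" "b \<le> padic_abs p x" "b \<le> padic_abs p y"
  shows "padic_abs p (inverse x - inverse y) \<le> padic_abs p (x - y) / (b * b)"
proof -
  have nz: "x \<noteq> 0" "y \<noteq> 0" using assms by auto
  have "padic_abs p (inverse x - inverse y) = padic_abs p (x - y) / (padic_abs p x * padic_abs p y)"
    unfolding inverse_diff_inverse[OF nz] padic_abs_minus[OF p] padic_abs_mult[OF p] padic_abs_inverse[OF p]
    by (simp add: divide_simps)
  also have "\<dots> \<le> padic_abs p (x - y) / (b * b)"
    using assms padic_abs_nonneg[OF p] by (intro divide_left_mono mult_mono mult_pos_pos) auto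
  finally show ?thesis .
qed

lemma padic_cauchy_inverse:
  assumes "padic_cauchy p X" "\<not> padic_vanishes p X"
  shows "padic_cauchy p (\<lambda>n. inverse (X n))"
  unfolding padic_cauchy_def
proof (intro allI impI)
  fix e :: real assume "e > 0"
  obtain b N where b: "b > 0" "\<And>n. n \<ge> N \<Longrightarrow> b \<le> padic_abs p (X n)"
    using padic_cauchy_not_vanishes[OF assms] by metis
  have "e * (b * b) > 0" using b \<open>e > 0\<close> by simp
  then obtain M where M: "\<forall>m\<ge>M. \<forall>n\<ge>M. padic_abs p (X m - X n) < e * (b * b)"
    using assms(1) unfolding padic_cauchy_def by meson
  have "padic_abs p (inverse (X m) - inverse (X n)) < e" if "m \<ge> max M N" "n \<ge> max M N" for m n
  proof -
    have "padic_abs p (X m - X n) / (b * b) < e" using M that b by (simp add: field_simps)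
    then show ?thesis using padic_abs_inverse_diff[of b "X m" "X n"] b that by fastforce
  qed
  then show "\<exists>N. \<forall>m\<ge>N. \<forall>n\<ge>N. padic_abs p (inverse (X m) - inverse (X n)) < e" by blast
qed

lemma padic_vanishes_diff_inverse:
  assumes X: "padic_cauchy p X" "\<not> padic_vanishes p X"
    and Y: "padic_cauchy p Y" "\<not> padic_vanishes p Y"
    and XY: "padic_vanishes p (\<lambda>n. X n - Y n)"
  shows "padic_vanishes p (\<lambda>n. inverse (X n) - inverse (Y n))"
  unfolding padic_vanishes_def
proof (intro allI impI)
  fix e :: real assume "e > 0"
  obtain b1 N1 where b1: "b1 > 0" "\<And>n. n \<ge> N1 \<Longrightarrow> b1 \<le> padic_abs p (X n)"
    using padic_cauchy_not_vanishes[OF X] by metis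
  obtain b2 N2 where b2: "b2 > 0" "\<And>n. n \<ge> N2 \<Longrightarrow> b2 \<le> padic_abs p (Y n)"
    using padic_cauchy_not_vanishes[OF Y] by metis
  define b where "b = min b1 b2"
  have b: "b > 0" using b1 b2 by (simp add: b_def)
  have "e * (b * b) > 0" using b \<open>e > 0\<close> by simp
  then obtain M where M: "\<forall>n\<ge>M. padic_abs p (X n - Y n) < e * (b * b)"
    using XY unfolding padic_vanishes_def by meson
  have "padic_abs p (inverse (X n) - inverse (Y n)) < e" if "n \<ge> max M (max N1 N2)" for n
  proof -
    have "padic_abs p (X n - Y n) / (b * b) < e" using M that b by (simp add: field_simps)
    moreover have "b \<le> padic_abs p (X n)" "b \<le> padic_abs p (Y n)"
      using b1(2)[of n] b2(2)[of n] that by (auto simp: b_def)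
    ultimately show ?thesis using padic_abs_inverse_diff[of b "X n" "Y n"] b by linarith
  qed
  then show "\<exists>N. \<forall>n\<ge>N. padic_abs p (inverse (X n) - inverse (Y n)) < e" by blast
qed

lemma padic_cauchy_convergent_abs:
  assumes "padic_cauchy p X"
  shows "convergent (\<lambda>n. padic_abs p (X n))"
proof -
  have "Cauchy (\<lambda>n. padic_abs p (X n))"
    unfolding Cauchy_def dist_real_def
    using assms padic_abs_diff_lipschitz[OF p] unfolding padic_cauchy_def
    by (meson order_le_less_trans)
  then show ?thesis by (simp add: Cauchy_convergent_iff)
qed

lemma padic_vanishes_iff: "padic_vanishes p X \<longleftrightarrow> (\<lambda>n. padic_abs p (X n)) \<longlonglongrightarrow> 0"
  by (simp add: padic_vanishes_def LIMSEQ_def dist_real_def padic_abs_nonneg[OF p])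

end

lemma padic_rel_refl: "padic_cauchy CARD('p) X \<Longrightarrow> padic_rel TYPE('p::prime_card) X X"
  by (simp add: padic_rel_def padic_vanishes_def)

lemma part_equivp_padic_rel: "part_equivp (padic_rel TYPE('p::prime_card))"
proof (rule part_equivpI)
  show "\<exists>X. padic_rel TYPE('p) X X"
    using padic_rel_refl[OF padic_cauchy_const[OF prime_card]] by blast
  show "symp (padic_rel TYPE('p))"
    by (auto simp: symp_def padic_rel_def padic_vanishes_def padic_abs_minus_commute[OF prime_card])
  show "transp (padic_rel TYPE('p))"
  proof (rule transpI)
    fix X Y Z assume "padic_rel TYPE('p) X Y" "padic_rel TYPE('p) Y Z"
    then show "padic_rel TYPE('p) X Z"
      using padic_vanishes_add[OF prime_card[where 'a='p], of "\<lambda>n. X n - Y n" "\<lambda>n. Y n - Z n"]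
      by (auto simp: padic_rel_def)
  qed
qed

typedef (overloaded) 'p padic =
  "{c. \<exists>X. padic_rel TYPE('p::prime_card) X X \<and> c = Collect (padic_rel TYPE('p) X)}"
  morphisms padic_class Abs_padic
  using padic_rel_refl[OF padic_cauchy_const[OF prime_card]] by blast

definition Padic :: "(nat \<Rightarrow> rat) \<Rightarrow> 'p::prime_card padic" where
  "Padic X = Abs_padic (Collect (padic_rel TYPE('p) X))"

definition rep_padic :: "'p::prime_card padic \<Rightarrow> nat \<Rightarrow> rat" where
  "rep_padic x = (SOME X. X \<in> padic_class x)"

definition cr_padic :: "(nat \<Rightarrow> rat) \<Rightarrow> 'p::prime_card padic \<Rightarrow> bool" where
  "cr_padic = (\<lambda>X x. padic_rel TYPE('p) X X \<and> Padic X = x)"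

lemma Quotient_padic:
  "Quotient (padic_rel TYPE('p)) Padic rep_padic (cr_padic :: _ \<Rightarrow> 'p::prime_card padic \<Rightarrow> bool)"
proof -
  interpret quot_type "padic_rel TYPE('p)" "Abs_padic :: _ \<Rightarrow> 'p padic" padic_class
    by unfold_locales
      (use padic_class[where 'p='p] in
        \<open>auto simp: part_equivp_padic_rel padic_class_inverse padic_class_inject intro!: Abs_padic_inverse\<close>)
  have "abs = Padic" "rep = rep_padic"
    by (auto simp: fun_eq_iff abs_def Padic_def rep_def rep_padic_def)
  then have "Quotient3 (padic_rel TYPE('p)) Padic (rep_padic :: 'p padic \<Rightarrow> _)"
    using Quotient by simp
  then show ?thesis
    by (rule Quotient3_to_Quotient) (unfold cr_padic_def)
qed

setup_lifting Quotient_padic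

lemma cr_padic_eq: "pcr_padic = (\<lambda>X (y::'p::prime_card padic). padic_cauchy CARD('p) X \<and> Padic X = y)"
  unfolding padic.pcr_cr_eq cr_padic_def padic_rel_def
  by (auto simp: padic_vanishes_def fun_eq_iff)

lemma Domainp_pcr_padic [transfer_domain_rule]:
  "Domainp (pcr_padic :: _ \<Rightarrow> 'p::prime_card padic \<Rightarrow> bool) = padic_cauchy CARD('p)"
  by (auto simp: cr_padic_eq fun_eq_iff Domainp_iff)

lemma padic_diff_vanishes_iff:
  fixes X Y :: "nat \<Rightarrow> rat"
  assumes "padic_rel TYPE('p::prime_card) X Y"
  shows "padic_vanishes CARD('p) X \<longleftrightarrow> padic_vanishes CARD('p) Y"
proof -
  have XY: "padic_vanishes CARD('p) (\<lambda>n. X n - Y n)" using assms by (simp add: padic_rel_def)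
  show ?thesis
    using padic_vanishes_diff[OF prime_card _ XY, of X] padic_vanishes_add[OF prime_card _ XY, of Y]
    by auto
qed

instantiation padic :: (prime_card) field
begin

lift_definition zero_padic :: "'a padic" is "\<lambda>n. 0"
  by (simp add: padic_rel_refl padic_cauchy_const[OF prime_card])

lift_definition one_padic :: "'a padic" is "\<lambda>n. 1"
  by (simp add: padic_rel_refl padic_cauchy_const[OF prime_card])

lift_definition plus_padic :: "'a padic \<Rightarrow> 'a padic \<Rightarrow> 'a padic" is "\<lambda>X Y n. X n + Y n"
  unfolding padic_rel_def add_diff_add
  by (simp add: padic_cauchy_add[OF prime_card] padic_vanishes_add[OF prime_card])

lift_definition uminus_padic :: "'a padic \<Rightarrow> 'a padic" is "\<lambda>X n. - X n"
  unfolding padic_rel_def minus_diff_minus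
  by (simp only: padic_cauchy_minus[OF prime_card] padic_vanishes_minus[OF prime_card] simp_thms)

lift_definition minus_padic :: "'a padic \<Rightarrow> 'a padic \<Rightarrow> 'a padic" is "\<lambda>X Y n. X n - Y n"
proof -
  fix X X' Y Y' :: "nat \<Rightarrow> rat"
  assume "padic_rel TYPE('a) X X'" "padic_rel TYPE('a) Y Y'"
  then show "padic_rel TYPE('a) (\<lambda>n. X n - Y n) (\<lambda>n. X' n - Y' n)"
    using padic_vanishes_diff[OF prime_card[where 'a='a], of "\<lambda>n. X n - X' n" "\<lambda>n. Y n - Y' n"]
    by (simp add: padic_rel_def padic_cauchy_diff[OF prime_card] algebra_simps)
qed

lift_definition times_padic :: "'a padic \<Rightarrow> 'a padic \<Rightarrow> 'a padic" is "\<lambda>X Y n. X n * Y n"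
proof -
  fix X X' Y Y' :: "nat \<Rightarrow> rat"
  assume *: "padic_rel TYPE('a) X X'" "padic_rel TYPE('a) Y Y'"
  then have "padic_vanishes CARD('a) (\<lambda>n. X n * (Y n - Y' n) + Y' n * (X n - X' n))"
    by (intro padic_vanishes_add[OF prime_card] padic_vanishes_mult_bounded[OF prime_card])
      (auto simp: padic_rel_def)
  with * show "padic_rel TYPE('a) (\<lambda>n. X n * Y n) (\<lambda>n. X' n * Y' n)"
    by (simp add: padic_rel_def padic_cauchy_mult[OF prime_card] mult_diff_mult mult.commute)
qed

lift_definition inverse_padic :: "'a padic \<Rightarrow> 'a padic"
  is "\<lambda>X. if padic_vanishes CARD('a) X then (\<lambda>n. 0) else (\<lambda>n. inverse (X n))"
proof -
  fix X Y :: "nat \<Rightarrow> rat"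
  assume "padic_rel TYPE('a) X Y"
  then show "padic_rel TYPE('a)
      (if padic_vanishes CARD('a) X then (\<lambda>n. 0) else (\<lambda>n. inverse (X n)))
      (if padic_vanishes CARD('a) Y then (\<lambda>n. 0) else (\<lambda>n. inverse (Y n)))"
    using padic_diff_vanishes_iff[of X Y, where 'p='a]
    by (auto simp: padic_rel_def padic_cauchy_const[OF prime_card] padic_vanishes_zero
        padic_cauchy_inverse[OF prime_card] padic_vanishes_diff_inverse[OF prime_card]
        padic_vanishes_def[of _ "\<lambda>_. 0"])
qed

definition divide_padic :: "'a padic \<Rightarrow> 'a padic \<Rightarrow> 'a padic" where
  "divide_padic x y = x * inverse y"

instance
proof
  fix a b c :: "'a padic"
  note c = padic_cauchy_add[OF prime_card] padic_cauchy_mult[OF prime_card]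
    padic_cauchy_minus[OF prime_card] padic_cauchy_diff[OF prime_card] padic_cauchy_const[OF prime_card]
    padic_vanishes_zero[OF prime_card] padic_vanishes_const[OF prime_card]
  show "a + b = b + a"
    by transfer (simp add: ac_simps padic_rel_def c)
  show "(a + b) + c = a + (b + c)"
    by transfer (simp add: ac_simps padic_rel_def c)
  show "0 + a = a"
    by transfer (simp add: padic_rel_def c)
  show "- a + a = 0"
    by transfer (simp add: padic_rel_def c)
  show "a - b = a + - b"
    by transfer (simp add: padic_rel_def c)
  show "(a * b) * c = a * (b * c)"
    by transfer (simp add: ac_simps padic_rel_def c)
  show "a * b = b * a"
    by transfer (simp add: ac_simps padic_rel_def c)
  show "1 * a = a"
    by transfer (simp add: padic_rel_def c)
  show "(a + b) * c = a * c + b * c"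
    by transfer (simp add: distrib_right padic_rel_def c)
  show "(0::'a padic) \<noteq> 1"
    by transfer (simp add: padic_rel_def c)
  have inv: "padic_vanishes CARD('a) (\<lambda>n. inverse (X n) * X n - 1)"
    if X: "padic_cauchy CARD('a) X" "\<not> padic_vanishes CARD('a) X" for X
  proof -
    obtain b N where "b > 0" "\<And>n. n \<ge> N \<Longrightarrow> b \<le> padic_abs CARD('a) (X n)"
      using padic_cauchy_not_vanishes[OF prime_card X] by metis
    then have "\<forall>n\<ge>N. X n \<noteq> 0" by (metis not_less padic_abs_0)
    then have "\<forall>n\<ge>N. inverse (X n) * X n - 1 = 0" by simp
    then show ?thesis unfolding padic_vanishes_def by (metis padic_abs_0)
  qed
  show "a \<noteq> 0 \<Longrightarrow> inverse a * a = 1"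
    by transfer (simp add: padic_rel_def c inv padic_cauchy_inverse[OF prime_card])
  show "a div b = a * inverse b"
    by (rule divide_padic_def)
  show "inverse (0::'a padic) = 0"
    by transfer (simp add: padic_rel_def c)
qed

end

lift_definition padic_norm :: "'a::prime_card padic \<Rightarrow> real" is "\<lambda>X. lim (\<lambda>n. padic_abs CARD('a) (X n))"
proof -
  fix X Y :: "nat \<Rightarrow> rat"
  assume *: "padic_rel TYPE('a) X Y"
  obtain l where l: "(\<lambda>n. padic_abs CARD('a) (Y n)) \<longlonglongrightarrow> l"
    using padic_cauchy_convergent_abs[OF prime_card[where 'a='a], of Y] *
    by (auto simp: padic_rel_def convergent_def)
  have "(\<lambda>n. padic_abs CARD('a) (X n) - padic_abs CARD('a) (Y n)) \<longlonglongrightarrow> 0"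
  proof (rule Lim_null_comparison)
    show "\<forall>\<^sub>F n in sequentially. norm (padic_abs CARD('a) (X n) - padic_abs CARD('a) (Y n))
        \<le> padic_abs CARD('a) (X n - Y n)"
      using padic_abs_diff_lipschitz[OF prime_card[where 'a='a]] by auto
    show "(\<lambda>n. padic_abs CARD('a) (X n - Y n)) \<longlonglongrightarrow> 0"
      using * by (simp add: padic_rel_def padic_vanishes_iff[OF prime_card])
  qed
  from tendsto_add[OF this l] have "(\<lambda>n. padic_abs CARD('a) (X n)) \<longlonglongrightarrow> l" by simp
  with l show "lim (\<lambda>n. padic_abs CARD('a) (X n)) = lim (\<lambda>n. padic_abs CARD('a) (Y n))"
    by (simp add: limI)
qed

lemma padic_tendsto_norm:
  assumes "padic_cauchy CARD('p) X"
  shows "(\<lambda>n. padic_abs CARD('p) (X n)) \<longlonglongrightarrow> padic_norm (Padic X :: 'p::prime_card padic)"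
proof -
  have "padic_norm (Padic X :: 'p padic) = lim (\<lambda>n. padic_abs CARD('p) (X n))"
    using padic_norm.transfer[where 'a='p] assms by (auto simp: cr_padic_eq rel_fun_def)
  then show ?thesis
    using padic_cauchy_convergent_abs[OF prime_card assms] by (simp add: convergent_LIMSEQ_iff)
qed

lemma padic_induct [case_names Padic, induct type: padic]:
  assumes "\<And>X. padic_cauchy CARD('p) X \<Longrightarrow> P (Padic X)"
  shows "P (x :: 'p::prime_card padic)"
proof -
  have "padic_cauchy CARD('p) (rep_padic x)" "Padic (rep_padic x) = x"
    using Quotient_rep_reflp[OF Quotient_padic, of x] Quotient_abs_rep[OF Quotient_padic, of x]
    by (simp_all add: padic_rel_def)
  then show ?thesis using assms by metis
qed

lemma Padic_eq_iff:
  assumes "padic_cauchy CARD('p) X" "padic_cauchy CARD('p) Y"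
  shows "(Padic X :: 'p::prime_card padic) = Padic Y \<longleftrightarrow> padic_vanishes CARD('p) (\<lambda>n. X n - Y n)"
  using padic.rel_eq_transfer[where 'p='p] assms
  by (auto simp: cr_padic_eq rel_fun_def padic_rel_def)

lemma Padic_add:
  assumes "padic_cauchy CARD('p) X" "padic_cauchy CARD('p) Y"
  shows "(Padic X :: 'p::prime_card padic) + Padic Y = Padic (\<lambda>n. X n + Y n)"
  using plus_padic.transfer[where 'a='p] assms by (simp add: cr_padic_eq rel_fun_def)

lemma Padic_diff:
  assumes "padic_cauchy CARD('p) X" "padic_cauchy CARD('p) Y"
  shows "(Padic X :: 'p::prime_card padic) - Padic Y = Padic (\<lambda>n. X n - Y n)"
  using minus_padic.transfer[where 'a='p] assms by (simp add: cr_padic_eq rel_fun_def)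

lemma Padic_mult:
  assumes "padic_cauchy CARD('p) X" "padic_cauchy CARD('p) Y"
  shows "(Padic X :: 'p::prime_card padic) * Padic Y = Padic (\<lambda>n. X n * Y n)"
  using times_padic.transfer[where 'a='p] assms by (simp add: cr_padic_eq rel_fun_def)

lemma Padic_zero: "(0 :: 'p::prime_card padic) = Padic (\<lambda>n. 0)"
  using zero_padic.transfer[where 'a='p] by (simp add: cr_padic_eq)

lemma Padic_one: "(1 :: 'p::prime_card padic) = Padic (\<lambda>n. 1)"
  using one_padic.transfer[where 'a='p] by (simp add: cr_padic_eq)

lemma padic_norm_nonneg [simp]: "0 \<le> padic_norm (x :: 'p::prime_card padic)"
proof (induct x)
  case (Padic X)
  show ?case
    using padic_tendsto_norm[OF Padic] padic_abs_nonneg[OF prime_card[where 'a='p]]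
    by (intro LIMSEQ_le_const) auto
qed

lemma padic_norm_eq_0_iff [simp]: "padic_norm (x :: 'p::prime_card padic) = 0 \<longleftrightarrow> x = 0"
proof (induct x)
  case (Padic X)
  have "padic_norm (Padic X :: 'p padic) = 0 \<longleftrightarrow> padic_vanishes CARD('p) X"
    using padic_tendsto_norm[OF Padic] padic_vanishes_iff[OF prime_card[where 'a='p], of X]
    by (metis LIMSEQ_unique)
  also have "\<dots> \<longleftrightarrow> (Padic X :: 'p padic) = 0"
    using Padic_eq_iff[OF Padic padic_cauchy_const[OF prime_card], of 0] by (simp add: Padic_zero)
  finally show ?case .
qed

lemma padic_norm_mult: "padic_norm (x * y :: 'p::prime_card padic) = padic_norm x * padic_norm y"
proof (induct x)
  case X: (Padic X)
  show ?case
  proof (induct y)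
    case Y: (Padic Y)
    show ?case
      using padic_tendsto_norm[OF padic_cauchy_mult[OF prime_card X Y]]
        tendsto_mult[OF padic_tendsto_norm[OF X] padic_tendsto_norm[OF Y]]
      by (simp add: Padic_mult[OF X Y] padic_abs_mult[OF prime_card] LIMSEQ_unique)
  qed
qed

lemma padic_norm_add: "padic_norm (x + y :: 'p::prime_card padic) \<le> max (padic_norm x) (padic_norm y)"
proof (induct x)
  case X: (Padic X)
  show ?case
  proof (induct y)
    case Y: (Padic Y)
    show ?case
      unfolding Padic_add[OF X Y]
      by (rule LIMSEQ_le[OF padic_tendsto_norm[OF padic_cauchy_add[OF prime_card X Y]]
            tendsto_max[OF padic_tendsto_norm[OF X] padic_tendsto_norm[OF Y]]])
        (auto intro: padic_abs_add[OF prime_card])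
  qed
qed

lemma padic_norm_one [simp]: "padic_norm (1 :: 'p::prime_card padic) = 1"
  using padic_norm_mult[of "1 :: 'p padic" 1] by simp

lemma padic_norm_minus [simp]: "padic_norm (- x :: 'p::prime_card padic) = padic_norm x"
proof -
  have "padic_norm (- 1 :: 'p padic) * padic_norm (- 1 :: 'p padic) = 1"
    by (simp flip: padic_norm_mult)
  then have "padic_norm (- 1 :: 'p padic) = 1"
    by (metis abs_of_nonneg abs_square_eq_1 padic_norm_nonneg power2_eq_square)
  then show ?thesis using padic_norm_mult[of "- 1" x] by simp
qed

lemma padic_norm_minus_commute: "padic_norm (x - y :: 'p::prime_card padic) = padic_norm (y - x)"
  using padic_norm_minus[of "x - y"] by simp

instantiation padic :: (prime_card) metric_space
begin

definition dist_padic :: "'a padic \<Rightarrow> 'a padic \<Rightarrow> real" where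
  "dist_padic x y = padic_norm (x - y)"

definition uniformity_padic :: "('a padic \<times> 'a padic) filter" where
  "uniformity_padic = (INF e\<in>{0<..}. principal {(x, y). dist x y < e})"

definition open_padic :: "'a padic set \<Rightarrow> bool" where
  "open_padic U \<longleftrightarrow> (\<forall>x\<in>U. eventually (\<lambda>(x', y). x' = x \<longrightarrow> y \<in> U) uniformity)"

instance
proof
  fix x y z :: "'a padic"
  show "dist x y = 0 \<longleftrightarrow> x = y" by (simp add: dist_padic_def)
  have "padic_norm (x - y) \<le> max (padic_norm (x - z)) (padic_norm (z - y))"
    using padic_norm_add[of "x - z" "z - y"] by simp
  also have "\<dots> \<le> padic_norm (x - z) + padic_norm (z - y)"
    using padic_norm_nonneg[of "x - z"] padic_norm_nonneg[of "z - y"] by linarith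
  finally show "dist x y \<le> dist x z + dist y z"
    by (simp add: dist_padic_def padic_norm_minus_commute[of y z])
qed (simp_all add: uniformity_padic_def open_padic_def)

end

lemma of_nat_padic: "(of_nat k :: 'p::prime_card padic) = Padic (\<lambda>n. of_nat k)"
  by (induct k) (simp_all add: Padic_zero Padic_one Padic_add padic_cauchy_const[OF prime_card])

lemma norm_Padic_const: "padic_norm (Padic (\<lambda>n. c) :: 'p::prime_card padic) = padic_abs CARD('p) c"
  using padic_tendsto_norm[OF padic_cauchy_const[OF prime_card[where 'a='p]], of c]
  by (simp add: LIMSEQ_const_iff)

instance padic :: (prime_card) field_char_0
proof
  show "inj (of_nat :: nat \<Rightarrow> 'a padic)"
    by (rule injI)
      (auto simp: of_nat_padic Padic_eq_iff padic_cauchy_const[OF prime_card] padic_vanishes_const[OF prime_card])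
qed

lemma of_int_padic: "(of_int k :: 'p::prime_card padic) = Padic (\<lambda>n. of_int k)"
proof (cases k)
  case (nonneg n)
  then show ?thesis by (simp add: of_nat_padic)
next
  case (neg n)
  have "(of_int k :: 'p padic) = 0 - of_nat (Suc n)" using neg by simp
  also have "\<dots> = Padic (\<lambda>_. of_int k)"
    unfolding of_nat_padic Padic_zero using neg by (simp add: Padic_diff padic_cauchy_const[OF prime_card])
  finally show ?thesis .
qed

lemma of_rat_padic: "(of_rat c :: 'p::prime_card padic) = Padic (\<lambda>n. c)"
proof -
  obtain a b where c: "b \<noteq> 0" "c = of_int a / of_int b"
    by (metis quotient_of_denom_pos quotient_of_div surj_pair less_irrefl)
  have "Padic (\<lambda>n. c) * (of_int b :: 'p padic) = of_int a"
    using c by (simp add: of_int_padic Padic_mult padic_cauchy_const[OF prime_card])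
  then have "Padic (\<lambda>n. c) = (of_int a / of_int b :: 'p padic)"
    using c(1) by (simp add: eq_divide_eq)
  then show ?thesis by (simp add: c(2) of_rat_divide)
qed

lemma norm_of_rat_padic [simp]: "padic_norm (of_rat c :: 'p::prime_card padic) = padic_abs CARD('p) c"
  by (simp add: of_rat_padic norm_Padic_const)

lemma norm_prime_padic: "padic_norm (of_nat CARD('p) :: 'p::prime_card padic) = 1 / CARD('p)"
proof -
  have p: "prime (int CARD('p))" using prime_card[where 'a='p] by simp
  then have "multiplicity (int CARD('p)) (int CARD('p)) = 1"
    by (intro multiplicity_self) auto
  moreover have "CARD('p) \<noteq> 0" using p by (metis not_prime_0 of_nat_0)
  ultimately have "padic_abs CARD('p) (of_nat CARD('p)) = 1 / CARD('p)"
    using padic_abs_frac[OF prime_card[where 'a='p], of "int CARD('p)" 1] by (simp add: power_int_minus_divide)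
  then show ?thesis by (simp add: of_nat_padic norm_Padic_const)
qed

lemma padic_of_rat_tendsto:
  assumes "padic_cauchy CARD('p) X"
  shows "(\<lambda>n. of_rat (X n)) \<longlonglongrightarrow> (Padic X :: 'p::prime_card padic)"
proof (rule metric_LIMSEQ_I)
  fix e :: real assume "e > 0"
  then have "e / 2 > 0" by simp
  then obtain N where N: "\<forall>m\<ge>N. \<forall>n\<ge>N. padic_abs CARD('p) (X m - X n) < e / 2"
    using assms unfolding padic_cauchy_def by meson
  have "dist (of_rat (X n)) (Padic X :: 'p padic) < e" if "n \<ge> N" for n
  proof -
    have c: "padic_cauchy CARD('p) (\<lambda>m. X n - X m)"
      by (intro padic_cauchy_diff[OF prime_card] padic_cauchy_const[OF prime_card] assms)
    have "padic_norm (Padic (\<lambda>m. X n - X m) :: 'p padic) \<le> e / 2"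
      by (rule LIMSEQ_le_const2[OF padic_tendsto_norm[OF c]]) (use N that less_imp_le in blast)
    then show ?thesis
      using \<open>e > 0\<close>
      by (simp add: dist_padic_def of_rat_padic Padic_diff[OF padic_cauchy_const[OF prime_card] assms])
  qed
  then show "\<exists>N. \<forall>n\<ge>N. dist (of_rat (X n)) (Padic X :: 'p padic) < e" by blast
qed

lemma padic_rat_dense:
  fixes x :: "'p::prime_card padic"
  assumes "e > 0"
  shows "\<exists>c. dist x (of_rat c) < e"
proof (induct x)
  case (Padic X)
  show ?case
    using metric_LIMSEQ_D[OF padic_of_rat_tendsto[OF Padic] assms] by (metis dist_commute order_refl)
qed

instance padic :: (prime_card) complete_space
proof
  fix X :: "nat \<Rightarrow> 'a padic"
  assume X: "Cauchy X"
  have "\<forall>n. \<exists>c. dist (X n) (of_rat c) < inverse (real (Suc n))"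
    by (intro allI padic_rat_dense) simp
  then obtain q where q: "\<And>n. dist (X n) (of_rat (q n)) < inverse (real (Suc n))"
    by metis
  have lim0: "(\<lambda>n. dist (X n) (of_rat (q n))) \<longlonglongrightarrow> 0"
  proof (rule Lim_null_comparison[OF _ LIMSEQ_inverse_real_of_nat])
    show "\<forall>\<^sub>F n in sequentially. norm (dist (X n) (of_rat (q n))) \<le> inverse (real (Suc n))"
      using less_imp_le[OF q] by (intro always_eventually allI) (simp only: real_norm_def abs_of_nonneg zero_le_dist)
  qed
  have "padic_cauchy CARD('a) q"
    unfolding padic_cauchy_def
  proof (intro allI impI)
    fix e :: real assume e: "e > 0"
    then have e3: "e / 3 > 0" by simp
    obtain N where N: "\<forall>m\<ge>N. \<forall>n\<ge>N. dist (X m) (X n) < e / 3"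
      using X e3 unfolding Cauchy_def by meson
    obtain M where M: "\<forall>n\<ge>M. dist (X n) (of_rat (q n)) < e / 3"
      using metric_LIMSEQ_D[OF lim0 e3] by auto
    have "padic_abs CARD('a) (q m - q n) < e" if "m \<ge> max M N" "n \<ge> max M N" for m n
    proof -
      have "padic_abs CARD('a) (q m - q n) = dist (of_rat (q m) :: 'a padic) (of_rat (q n))"
        by (simp add: dist_padic_def flip: of_rat_diff)
      also have "\<dots> \<le> dist (X m) (of_rat (q m)) + dist (X m) (X n) + dist (X n) (of_rat (q n))"
        by metric
      also have "\<dots> < e"
      proof -
        have "dist (X m) (X n) < e / 3" using N that by auto
        moreover have "dist (X m) (of_rat (q m)) < e / 3" "dist (X n) (of_rat (q n)) < e / 3"
          using M that by auto
        ultimately show ?thesis by linarith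
      qed
      finally show ?thesis .
    qed
    then show "\<exists>N. \<forall>m\<ge>N. \<forall>n\<ge>N. padic_abs CARD('a) (q m - q n) < e" by blast
  qed
  then have "(\<lambda>n. dist (of_rat (q n)) (Padic q :: 'a padic)) \<longlonglongrightarrow> 0"
    by (intro tendsto_dist_iff[THEN iffD1] padic_of_rat_tendsto)
  from tendsto_add[OF lim0 this]
  have lim: "(\<lambda>n. dist (X n) (of_rat (q n)) + dist (of_rat (q n) :: 'a padic) (Padic q)) \<longlonglongrightarrow> 0" by simp
  have "(\<lambda>n. dist (X n) (Padic q)) \<longlonglongrightarrow> 0"
    by (rule tendsto_sandwich[OF _ _ tendsto_const lim]) (simp_all add: dist_triangle)
  then have "X \<longlonglongrightarrow> Padic q" by (rule tendsto_dist_iff[THEN iffD2])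
  then show "convergent X" by (auto simp: convergent_def)
qed


section \<open>Haar measure, weighted Lebesgue spaces and the operator\<close>

definition is_padic_haar :: "'p::prime_card padic measure \<Rightarrow> bool" where
  "is_padic_haar M \<longleftrightarrow> sets M = sets borel
     \<and> (\<forall>a. \<forall>A\<in>sets borel. emeasure M ((+) a ` A) = emeasure M A)
     \<and> emeasure M {x. padic_norm x \<le> 1} = 1"

definition units_measure :: "'p::prime_card padic measure \<Rightarrow> 'p padic measure" where
  "units_measure M = restrict_space M (- {0})"

definition Lq :: "'p::prime_card padic measure \<Rightarrow> real \<Rightarrow> real \<Rightarrow> ('p padic \<Rightarrow> real) set" where
  "Lq M q \<theta> = {f \<in> borel_measurable (units_measure M).
     integrable (units_measure M) (\<lambda>x. \<bar>f x\<bar> powr q * padic_norm x powr \<theta>)}"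

definition Lq_norm :: "'p::prime_card padic measure \<Rightarrow> real \<Rightarrow> real \<Rightarrow> ('p padic \<Rightarrow> real) \<Rightarrow> real" where
  "Lq_norm M q \<theta> f = (LINT x|units_measure M. \<bar>f x\<bar> powr q * padic_norm x powr \<theta>) powr (1 / q)"

definition Linf :: "'p::prime_card padic measure \<Rightarrow> ('p padic \<Rightarrow> real) set" where
  "Linf M = {f \<in> borel_measurable (units_measure M).
     esssup (units_measure M) (\<lambda>x. ereal \<bar>f x\<bar>) < \<infinity>}"

definition Linf_norm :: "'p::prime_card padic measure \<Rightarrow> ('p padic \<Rightarrow> real) \<Rightarrow> real" where
  "Linf_norm M f = real_of_ereal (esssup (units_measure M) (\<lambda>x. ereal \<bar>f x\<bar>))"

definition H_integrand ::
  "real \<Rightarrow> real \<Rightarrow> real \<Rightarrow> ('p::prime_card padic \<Rightarrow> real) \<Rightarrow> 'p padic \<Rightarrow> 'p padic \<Rightarrow> real" where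
  "H_integrand lam \<mu> \<nu> f y x =
     padic_norm x powr \<mu> * padic_norm y powr \<nu> / (max (padic_norm x) (padic_norm y)) powr lam * f x"

definition H_op :: "'p::prime_card padic measure \<Rightarrow>
    real \<Rightarrow> real \<Rightarrow> real \<Rightarrow> ('p padic \<Rightarrow> real) \<Rightarrow> 'p padic \<Rightarrow> real" where
  "H_op M lam \<mu> \<nu> f y = (LINT x|units_measure M. H_integrand lam \<mu> \<nu> f y x)"

text \<open>
  \<open>X\<close> and \<open>Y\<close> are function spaces with norms \<open>nX\<close> and \<open>nY\<close>. Since \<open>nY\<close> is real-valued, finiteness
  of the \<open>Y\<close>-norm of the image is the condition that the image lies in \<open>Y\<close>.
\<close>

definition H_bounded :: "'p::prime_card padic measure \<Rightarrow> real \<Rightarrow> real \<Rightarrow> real \<Rightarrow>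
    ('p padic \<Rightarrow> real) set \<Rightarrow> (('p padic \<Rightarrow> real) \<Rightarrow> real) \<Rightarrow>
    ('p padic \<Rightarrow> real) set \<Rightarrow> (('p padic \<Rightarrow> real) \<Rightarrow> real) \<Rightarrow> bool" where
  "H_bounded M lam \<mu> \<nu> X nX Y nY \<longleftrightarrow>
     (\<forall>f\<in>X. AE y in units_measure M. integrable (units_measure M) (H_integrand lam \<mu> \<nu> f y))
     \<and> (\<exists>C. \<forall>f\<in>X. H_op M lam \<mu> \<nu> f \<in> Y \<and> nY (H_op M lam \<mu> \<nu> f) \<le> C * nX f)"

end

theory Submission
  imports Defs "HOL-Real_Asymp.Real_Asymp"
begin

text \<open>
  Test the operator on truncated powers \<open>f = |x|\<^sup>s \<one>\<^sub>A\<close>, where \<open>A\<close> is a union of \<open>N\<close> spheres around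
  \<open>0\<close>. For \<open>s = -(\<alpha> + 1) / q\<close> (and \<open>s = 0\<close> if \<open>q = \<infinity>\<close>) every sphere contributes equally to the
  norm of \<open>f\<close>, which is therefore of order \<open>N\<^bsup>1/q\<^esup>\<close>. The kernel is positive, so \<open>H f\<close> at \<open>y\<close> is
  at least the integral over the sphere through \<open>y\<close>, a constant times \<open>|y|\<^bsup>\<mu>+\<nu>-\<lambda>+1\<^esup> f y\<close>. Hence the
  \<open>r\<close>-th power of the norm of \<open>H f\<close> is at least a constant times \<open>\<Sum>k\<in>K. p\<^bsup>kD\<^esup>\<close>, where \<open>K\<close> is the set
  of exponents of the radii and \<open>D\<close> does not depend on \<open>K\<close>. For \<open>K\<close> on the side of \<open>0\<close> where
  \<open>kD \<ge> 0\<close> this sum is at least \<open>N\<close>, and boundedness would give \<open>N\<^bsup>1/r\<^esup> \<le> C N\<^bsup>1/q\<^esup>\<close> for all \<open>N\<close>,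
  contradicting \<open>r < q\<close>.
\<close>

section \<open>Residues of \<open>p\<close>-integral rational numbers\<close>

context
  fixes p :: nat
  assumes p: "prime p"
begin

lemma padic_abs_of_int:
  "n \<noteq> 0 \<Longrightarrow> padic_abs p (of_int n) = real p powi (- int (multiplicity (int p) n))"
  using padic_abs_frac[OF p, of n 1] by simp

lemma padic_abs_of_int_le_1: "padic_abs p (of_int n) \<le> 1"
proof (cases "n = 0")
  case False
  then show ?thesis
    using prime_gt_0_nat[OF p] by (simp add: padic_abs_of_int power_int_minus field_simps)
qed simp

lemma padic_abs_of_int_less_1_iff: "padic_abs p (of_int n) < 1 \<longleftrightarrow> int p dvd n"
proof (cases "n = 0")
  case False
  have "real p powi (- int m) < 1 \<longleftrightarrow> 0 < m" for m
    using prime_gt_1_nat[OF p]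
    by (cases "m = 0") (auto simp: power_int_minus intro: inverse_less_1_iff[THEN iffD2])
  then show ?thesis
    using False prime_gt_1_nat[OF p] by (simp add: padic_abs_of_int multiplicity_gt_zero_iff)
qed simp

lemma padic_abs_le_1_imp_not_dvd_denominator:
  assumes "padic_abs p (of_int a / of_int b) \<le> 1" "coprime a b" "b \<noteq> 0"
  shows "\<not> int p dvd b"
proof
  assume dvd_b: "int p dvd b"
  have "padic_abs p (of_int a) = padic_abs p (of_int a / of_int b) * padic_abs p (of_int b)"
    using assms(3) by (simp flip: padic_abs_mult[OF p])
  also have "\<dots> \<le> padic_abs p (of_int b)"
    using assms(1) padic_abs_nonneg[OF p] by (simp add: mult_left_le_one_le)
  also have "\<dots> < 1"
    using dvd_b by (simp add: padic_abs_of_int_less_1_iff)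
  finally have "int p dvd a"
    by (simp add: padic_abs_of_int_less_1_iff)
  with dvd_b assms(2) show False
    using p coprime_common_divisor[of a b "int p"] by auto
qed

lemma ex_residue_of_fraction:
  assumes "\<not> int p dvd b"
  shows "\<exists>i<p. int p dvd a - int i * b"
proof -
  have "coprime b (int p)"
    using p assms prime_imp_coprime[of "int p" b] by (simp add: coprime_commute)
  then obtain b' where "[b * b' = 1] (mod int p)"
    using cong_solve_coprime_int by blast
  then have inverse: "[a * (b * b') = a * 1] (mod int p)"
    by (intro cong_mult) auto
  define i where "i = nat ((a * b') mod int p)"
  have i: "i < p" "int i = (a * b') mod int p"
    using prime_gt_0_nat[OF p] by (auto simp: i_def nat_less_iff)
  have "[int i * b = a * b' * b] (mod int p)"
    unfolding i(2) by (intro cong_scalar_right) simp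
  also have "a * b' * b = a * (b * b')" by simp
  also note inverse
  finally have "int p dvd a - int i * b"
    by (simp add: cong_iff_dvd_diff dvd_diff_commute)
  with i(1) show ?thesis by blast
qed

lemma padic_abs_le_1_imp_ex_residue:
  assumes "padic_abs p c \<le> 1"
  shows "\<exists>i<p. padic_abs p (c - of_nat i) < 1"
proof -
  obtain a b where quotient: "quotient_of c = (a, b)" by (cases "quotient_of c")
  have b: "b > 0" "coprime a b" and c: "c = of_int a / of_int b"
    using quotient_of_denom_pos[OF quotient] quotient_of_coprime[OF quotient]
      quotient_of_div[OF quotient] by auto
  have unit: "\<not> int p dvd b"
    using padic_abs_le_1_imp_not_dvd_denominator assms b unfolding c by simp
  then obtain i where i: "i < p" "int p dvd a - int i * b"
    using ex_residue_of_fraction by blast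
  have "(c - of_nat i) * of_int b = of_int (a - int i * b)"
    using b(1) by (simp add: c field_simps)
  then have "padic_abs p (c - of_nat i) * padic_abs p (of_int b) < 1"
    using i(2) padic_abs_of_int_less_1_iff[of "a - int i * b"] by (simp flip: padic_abs_mult[OF p])
  moreover have "padic_abs p (of_int b) = 1"
    using unit padic_abs_of_int_less_1_iff[of b] padic_abs_of_int_le_1[of b] by linarith
  ultimately show ?thesis using i(1) by auto
qed

end

section \<open>The value group and the residue field\<close>

lemma prime_card_gt_1: "1 < real CARD('p::prime_card)"
  using prime_gt_1_nat[OF prime_card[where 'a='p]] by simp

lemma padic_norm_zero [simp]: "padic_norm (0 :: 'p::prime_card padic) = 0"
  by simp

lemma padic_norm_pos_iff [simp]: "0 < padic_norm (x :: 'p::prime_card padic) \<longleftrightarrow> x \<noteq> 0"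
  by (simp add: less_le)

lemma padic_norm_diff_le:
  "padic_norm (x - y :: 'p::prime_card padic) \<le> max (padic_norm x) (padic_norm y)"
  using padic_norm_add[of x "- y"] by simp

lemma padic_norm_eqI:
  fixes x y :: "'p::prime_card padic"
  assumes "padic_norm (x - y) < padic_norm x"
  shows "padic_norm y = padic_norm x"
  using assms padic_norm_add[of "x - y" y] padic_norm_diff_le[of x "x - y"] by simp

lemma padic_norm_power: "padic_norm (x ^ n :: 'p::prime_card padic) = padic_norm x ^ n"
  by (induct n) (simp_all add: padic_norm_mult)

lemma padic_norm_inverse: "padic_norm (inverse x :: 'p::prime_card padic) = inverse (padic_norm x)"
proof (cases "x = 0")
  case False
  then have "padic_norm x * padic_norm (inverse x) = 1"
    by (simp flip: padic_norm_mult)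
  then show ?thesis by (rule inverse_unique[symmetric])
qed simp

lemma padic_norm_divide: "padic_norm (x / y :: 'p::prime_card padic) = padic_norm x / padic_norm y"
  by (simp add: divide_inverse padic_norm_mult padic_norm_inverse)

lemma padic_norm_power_int: "padic_norm (x powi k :: 'p::prime_card padic) = padic_norm x powi k"
  by (simp add: power_int_def padic_norm_power padic_norm_inverse)

lemma padic_norm_of_int: "padic_norm (of_int n :: 'p::prime_card padic) = padic_abs CARD('p) (of_int n)"
  by (simp flip: norm_of_rat_padic)

lemma padic_norm_of_int_less_1_iff:
  "padic_norm (of_int n :: 'p::prime_card padic) < 1 \<longleftrightarrow> int CARD('p) dvd n"
  by (simp add: padic_norm_of_int padic_abs_of_int_less_1_iff[OF prime_card])

lemma padic_norm_of_nat_le_1: "padic_norm (of_nat n :: 'p::prime_card padic) \<le> 1"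
  using padic_abs_of_int_le_1[OF prime_card[where 'a='p], of "int n"]
    padic_norm_of_int[of "int n", where 'p='p] by simp

text \<open>Near a nonzero point the norm is constant, so its values are those attained on \<open>\<rat>\<close>.\<close>
lemma padic_norm_eq_powrE:
  fixes x :: "'p::prime_card padic"
  assumes "x \<noteq> 0"
  obtains k :: int where "padic_norm x = CARD('p) powr k"
proof -
  obtain c where "padic_norm (x - of_rat c) < padic_norm x"
    using padic_rat_dense[of "padic_norm x" x] assms by (auto simp: dist_padic_def)
  then have norm: "padic_norm x = padic_abs CARD('p) c"
    by (metis padic_norm_eqI norm_of_rat_padic)
  then have "c \<noteq> 0" using assms by auto
  with norm obtain k :: int where "padic_norm x = CARD('p) powi k"
    by (auto simp: padic_abs_def)
  then show thesis
    using that[of k] prime_card_gt_1[where 'p='p] by (simp add: powr_real_of_int')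
qed

lemma ex_padic_norm_eq_powr:
  fixes k :: int
  shows "\<exists>t :: 'p::prime_card padic. padic_norm t = CARD('p) powr k"
proof
  show "padic_norm (of_nat CARD('p) powi (- k) :: 'p padic) = CARD('p) powr k"
    using prime_card_gt_1[where 'p='p]
    by (simp add: padic_norm_power_int norm_prime_padic power_int_minus powr_real_of_int'
        power_int_divide_distrib padic_norm_inverse)
qed

lemma ex_padic_residue:
  fixes x :: "'p::prime_card padic"
  assumes "padic_norm x \<le> 1"
  shows "\<exists>i<CARD('p). padic_norm (x - of_nat i) < 1"
proof -
  obtain c where c: "padic_norm (x - of_rat c) < 1"
    using padic_rat_dense[of 1 x] by (auto simp: dist_padic_def)
  then have "padic_abs CARD('p) c \<le> 1"
    using padic_norm_diff_le[of x "x - of_rat c"] assms by simp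
  then obtain i where i: "i < CARD('p)" "padic_abs CARD('p) (c - of_nat i) < 1"
    using padic_abs_le_1_imp_ex_residue[OF prime_card[where 'a='p]] by blast
  then have "padic_norm (of_rat c - of_nat i :: 'p padic) < 1"
    by (simp flip: norm_of_rat_padic add: of_rat_diff)
  with c have "padic_norm (x - of_nat i) < 1"
    using padic_norm_add[of "x - of_rat c" "of_rat c - of_nat i"] by simp
  with i(1) show ?thesis by blast
qed

lemma padic_residue_unique:
  fixes x :: "'p::prime_card padic"
  assumes "padic_norm (x - of_nat i) < 1" "padic_norm (x - of_nat j) < 1"
    and "i < CARD('p)" "j < CARD('p)"
  shows "i = j"
proof (rule ccontr)
  assume "i \<noteq> j"
  have "padic_norm (of_int (int i - int j) :: 'p padic) < 1"
    using assms(1,2) padic_norm_diff_le[of "x - of_nat j" "x - of_nat i"] by simp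
  then have "int CARD('p) dvd int i - int j"
    by (simp only: padic_norm_of_int_less_1_iff)
  then show False
    using assms(3,4) \<open>i \<noteq> j\<close> zdvd_imp_le[of "int CARD('p)" "\<bar>int i - int j\<bar>"] by auto
qed

section \<open>Balls and spheres\<close>

lemma mem_ball_padic_scaled:
  fixes t :: "'p::prime_card padic"
  assumes "t \<noteq> 0"
  shows "z \<in> ball (x + a * t) (padic_norm t) \<longleftrightarrow> padic_norm ((z - x) / t - a) < 1"
proof -
  have "z - (x + a * t) = ((z - x) / t - a) * t"
    using assms by (simp add: field_simps)
  then have "dist z (x + a * t) = padic_norm ((z - x) / t - a) * padic_norm t"
    by (simp add: dist_padic_def padic_norm_mult)
  then show ?thesis
    using assms by (simp add: dist_commute)
qed

lemma mem_cball_padic_scaled: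
  fixes t :: "'p::prime_card padic"
  assumes "t \<noteq> 0"
  shows "z \<in> cball x (padic_norm t) \<longleftrightarrow> padic_norm ((z - x) / t) \<le> 1"
  using assms by (simp add: padic_norm_divide dist_padic_def padic_norm_minus_commute)

lemma cball_padic_eq_UN_ball:
  fixes t :: "'p::prime_card padic"
  assumes "t \<noteq> 0"
  shows "cball x (padic_norm t) = (\<Union>i<CARD('p). ball (x + of_nat i * t) (padic_norm t))"
proof -
  have "padic_norm u \<le> 1 \<longleftrightarrow> (\<exists>i<CARD('p). padic_norm (u - of_nat i) < 1)" for u :: "'p padic"
  proof
    assume "\<exists>i<CARD('p). padic_norm (u - of_nat i) < 1"
    then obtain i where "padic_norm (u - of_nat i) < 1" by blast
    then show "padic_norm u \<le> 1"
      using padic_norm_add[of "u - of_nat i" "of_nat i"] padic_norm_of_nat_le_1[of i, where 'p='p]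
      by simp
  qed (rule ex_padic_residue)
  then show ?thesis
    by (simp add: set_eq_iff mem_cball_padic_scaled[OF assms] mem_ball_padic_scaled[OF assms]
        Bex_def del: mem_ball mem_cball)
qed

lemma disjoint_family_ball_padic:
  fixes t :: "'p::prime_card padic"
  assumes "t \<noteq> 0"
  shows "disjoint_family_on (\<lambda>i. ball (x + of_nat i * t) (padic_norm t)) {..<CARD('p)}"
  using padic_residue_unique[where 'p='p]
  by (auto simp: disjoint_family_on_def mem_ball_padic_scaled[OF assms] simp del: mem_ball)

lemma ball_padic_eq_cball:
  "ball x (CARD('p) powr (of_int k + 1)) = cball (x :: 'p::prime_card padic) (CARD('p) powr k)"
  for k :: int
proof -
  have "padic_norm u < CARD('p) powr (of_int k + 1) \<longleftrightarrow> padic_norm u \<le> CARD('p) powr k"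
    for u :: "'p padic"
  proof (cases "u = 0")
    case False
    then obtain m :: int where "padic_norm u = CARD('p) powr m" by (rule padic_norm_eq_powrE)
    then show ?thesis using prime_card_gt_1[where 'p='p] by simp linarith
  qed (use prime_card_gt_1[where 'p='p] in simp)
  then show ?thesis by (auto simp: dist_padic_def)
qed

lemma image_add_ball_padic:
  fixes a x :: "'p::prime_card padic"
  shows "(+) a ` ball x e = ball (a + x) e"
proof -
  have "z \<in> (+) a ` ball x e \<longleftrightarrow> z - a \<in> ball x e" for z
    by (auto simp: image_iff intro: bexI[of _ "z - a"])
  then show ?thesis by (auto simp: dist_padic_def algebra_simps)
qed

lemma disjoint_family_sphere_padic:
  "disjoint_family_on (\<lambda>k. sphere (x :: 'p::prime_card padic) (CARD('p) powr real_of_int k)) K"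
  using prime_card_gt_1[where 'p='p] by (auto simp: disjoint_family_on_def powr_inj)

lemma borel_measurable_padic_norm [measurable]:
  "(padic_norm :: 'p::prime_card padic \<Rightarrow> real) \<in> borel_measurable borel"
proof -
  have "padic_norm = (\<lambda>x :: 'p padic. dist x 0)" by (simp add: dist_padic_def fun_eq_iff)
  moreover have "continuous_on UNIV (\<lambda>x :: 'p padic. dist x 0)" by (intro continuous_intros)
  ultimately show ?thesis by (metis borel_measurable_continuous_onI)
qed

lemma sphere_0_eq_padic_norm: "sphere (0 :: 'p::prime_card padic) e = {x. padic_norm x = e}"
  by (auto simp: dist_padic_def)

lemma sphere_0_padic_borel [measurable]: "sphere (0 :: 'p::prime_card padic) e \<in> sets borel"
  unfolding sphere_0_eq_padic_norm by measurable

section \<open>Haar measure of balls and spheres\<close>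

locale padic_haar =
  fixes M :: "'p::prime_card padic measure"
  assumes is_padic_haar: "is_padic_haar M"
begin

lemma sets_haar [measurable_cong]: "sets M = sets borel"
  using is_padic_haar by (simp add: is_padic_haar_def)

lemma emeasure_ball_translate: "emeasure M (ball (a + x) e) = emeasure M (ball x e)"
  using is_padic_haar unfolding is_padic_haar_def
  by (metis image_add_ball_padic borel_open open_ball)

lemma emeasure_cball_eq_ball:
  fixes t :: "'p padic"
  assumes "t \<noteq> 0"
  shows "emeasure M (cball x (padic_norm t)) = CARD('p) * emeasure M (ball x (padic_norm t))"
proof -
  have "emeasure M (cball x (padic_norm t))
      = (\<Sum>i<CARD('p). emeasure M (ball (x + of_nat i * t) (padic_norm t)))"
    unfolding cball_padic_eq_UN_ball[OF assms]
    by (rule sum_emeasure[symmetric]) (auto simp: sets_haar disjoint_family_ball_padic assms)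
  also have "\<dots> = (\<Sum>i<CARD('p). emeasure M (ball x (padic_norm t)))"
    by (simp add: emeasure_ball_translate add.commute[of x])
  finally show ?thesis by (simp add: ennreal_of_nat_eq_real_of_nat)
qed

lemma emeasure_cball_add_one:
  "emeasure M (cball x (CARD('p) powr (of_int k + 1)))
    = ennreal CARD('p) * emeasure M (cball x (CARD('p) powr k))"
  for k :: int
proof -
  obtain t :: "'p padic" where t: "padic_norm t = CARD('p) powr (of_int k + 1)"
    using ex_padic_norm_eq_powr[of "k + 1", where 'p='p] by auto
  then have "t \<noteq> 0" using prime_card_gt_1[where 'p='p] by auto
  then show ?thesis
    using emeasure_cball_eq_ball[of t x]
    by (simp add: t ball_padic_eq_cball ennreal_of_nat_eq_real_of_nat)
qed

lemma emeasure_cball: "emeasure M (cball x (CARD('p) powr k)) = ennreal (CARD('p) powr k)"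
  for k :: int
proof (induct k rule: int_induct[where k = 0])
  case base
  have "emeasure M (cball x (CARD('p) powr 0)) = emeasure M (cball 0 (CARD('p) powr 0))"
    using emeasure_ball_translate[of x 0] ball_padic_eq_cball[of _ 0, where 'p='p]
    by (metis add.right_neutral of_int_0)
  also have "\<dots> = 1"
    using is_padic_haar prime_card_gt_1[where 'p='p]
    by (simp add: is_padic_haar_def cball_def dist_padic_def)
  finally show ?case using prime_card_gt_1[where 'p='p] by simp
next
  case (step1 k)
  then have "emeasure M (cball x (CARD('p) powr (k + 1))) = ennreal (CARD('p) * CARD('p) powr k)"
    by (simp add: emeasure_cball_add_one ennreal_mult)
  also have "CARD('p) * CARD('p) powr k = CARD('p) powr (k + 1)"
    using prime_card_gt_1[where 'p='p] by (simp add: powr_add)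
  finally show ?case .
next
  case (step2 k)
  have "ennreal CARD('p) * emeasure M (cball x (CARD('p) powr (k - 1))) = ennreal (CARD('p) powr k)"
    using emeasure_cball_add_one[of x "k - 1"] step2 by simp
  also have "\<dots> = ennreal CARD('p) * ennreal (CARD('p) powr (k - 1))"
    using prime_card_gt_1[where 'p='p] by (simp add: powr_diff flip: ennreal_mult)
  finally show ?case
    using prime_card_gt_1[where 'p='p] by (simp add: ennreal_mult_cancel_left)
qed

lemma emeasure_sphere:
  "emeasure M (sphere x (CARD('p) powr k)) = ennreal (CARD('p) powr k * (1 - 1 / CARD('p)))"
  for k :: int
proof -
  let ?p = "real CARD('p)"
  have p: "1 < ?p" by (rule prime_card_gt_1)
  have inner: "ball x (?p powr k) = cball x (?p powr (k - 1))"
    using ball_padic_eq_cball[of x "k - 1"] by simp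
  have "sphere x (?p powr k) = cball x (?p powr k) - ball x (?p powr k)" by auto
  also have "emeasure M \<dots> = emeasure M (cball x (?p powr k)) - emeasure M (ball x (?p powr k))"
    using emeasure_cball[of x "k - 1"]
    by (intro emeasure_Diff ball_subset_cball) (auto simp: sets_haar inner)
  also have "\<dots> = ennreal (?p powr k) - ennreal (?p powr (k - 1))"
    using emeasure_cball[of x k] emeasure_cball[of x "k - 1"] by (simp add: inner)
  also have "\<dots> = ennreal (?p powr k * (1 - 1 / ?p))"
    using p by (simp add: powr_diff algebra_simps flip: ennreal_minus)
  finally show ?thesis .
qed

lemma borel_measurable_units_measure:
  "f \<in> borel_measurable borel \<Longrightarrow> f \<in> borel_measurable (units_measure M)"
  unfolding units_measure_def
  by (rule measurable_restrict_space1) (simp cong: measurable_cong_sets add: sets_haar)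

lemma has_bochner_integral_indicator_sphere:
  "has_bochner_integral (units_measure M) (indicator (sphere 0 (CARD('p) powr k)))
     (CARD('p) powr k * (1 - 1 / CARD('p)))"
  for k :: int
proof -
  let ?S = "sphere 0 (CARD('p) powr k) :: 'p padic set"
  have p: "1 < real CARD('p)" by (rule prime_card_gt_1)
  have units: "- {0} \<inter> space M \<in> sets M" "?S \<subseteq> - {0}"
    using p by (auto simp: sets_haar sets_eq_imp_space_eq[OF sets_haar])
  have "emeasure (units_measure M) ?S = ennreal (CARD('p) powr k * (1 - 1 / CARD('p)))"
    unfolding units_measure_def emeasure_restrict_space[OF units] by (rule emeasure_sphere)
  moreover have "?S \<in> sets (units_measure M)"
    unfolding units_measure_def sets_restrict_space_iff[OF units(1)]
    using units by (simp add: sets_haar)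
  ultimately show ?thesis
    using has_bochner_integral_real_indicator[of ?S "units_measure M"] p by (simp add: measure_def)
qed

end

section \<open>The norms of \<open>L\<^sup>q\<close> and \<open>L\<^sup>\<infinity>\<close>\<close>

lemma Lq_norm_nonneg: "0 \<le> Lq_norm M q \<theta> f"
  by (simp add: Lq_norm_def)

lemma Lq_norm_cmult:
  assumes "0 < q"
  shows "Lq_norm M q \<theta> (\<lambda>x. c * f x) = \<bar>c\<bar> * Lq_norm M q \<theta> f"
proof -
  have "\<bar>c * f x\<bar> powr q * padic_norm x powr \<theta>
      = \<bar>c\<bar> powr q * (\<bar>f x\<bar> powr q * padic_norm x powr \<theta>)" for x
    by (simp add: abs_mult powr_mult)
  then show ?thesis
    using assms unfolding Lq_norm_def
    by (simp only: integral_mult_right_zero) (simp add: powr_mult powr_powr)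
qed

lemma Lq_cmult:
  assumes "f \<in> Lq M q \<theta>"
  shows "(\<lambda>x. c * f x) \<in> Lq M q \<theta>"
  using assms by (auto simp: Lq_def abs_mult powr_mult mult.assoc)

lemma Lq_norm_mono_AE:
  assumes "f \<in> Lq M q \<theta>" "g \<in> Lq M q \<theta>" "0 < q"
    and "AE x in units_measure M. \<bar>f x\<bar> \<le> \<bar>g x\<bar>"
  shows "Lq_norm M q \<theta> f \<le> Lq_norm M q \<theta> g"
  unfolding Lq_norm_def
proof (intro powr_mono2 integral_mono_AE)
  show "AE x in units_measure M.
      \<bar>f x\<bar> powr q * padic_norm x powr \<theta> \<le> \<bar>g x\<bar> powr q * padic_norm x powr \<theta>"
    using assms(4) by eventually_elim (use assms(3) in \<open>auto intro!: mult_right_mono powr_mono2\<close>)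
qed (use assms in \<open>auto simp: Lq_def\<close>)

lemma bounded_in_Linf:
  assumes "f \<in> borel_measurable (units_measure M)" "0 \<le> c"
    and "AE x in units_measure M. \<bar>f x\<bar> \<le> c"
  shows "f \<in> Linf M" "Linf_norm M f \<le> c"
proof -
  have le: "esssup (units_measure M) (\<lambda>x. ereal \<bar>f x\<bar>) \<le> ereal c"
    using assms by (intro esssup_I) auto
  then show "f \<in> Linf M" using assms(1) by (auto simp: Linf_def)
  show "Linf_norm M f \<le> c"
    using le assms(2) unfolding Linf_norm_def
    by (cases "esssup (units_measure M) (\<lambda>x. ereal \<bar>f x\<bar>)") auto
qed

lemma Linf_norm_nonneg:
  assumes "f \<in> borel_measurable (units_measure M)"
  shows "0 \<le> Linf_norm M f"
proof (cases "emeasure (units_measure M) (space (units_measure M)) = 0")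
  case True
  then show ?thesis using assms by (simp add: Linf_norm_def esssup_zero_space)
next
  case False
  then have "0 = esssup (units_measure M) (\<lambda>x. 0 :: ereal)" by (simp add: esssup_const)
  also have "\<dots> \<le> esssup (units_measure M) (\<lambda>x. ereal \<bar>f x\<bar>)" by (intro esssup_mono) auto
  finally show ?thesis by (simp add: Linf_norm_def real_of_ereal_pos)
qed

section \<open>Truncated powers of the norm\<close>

definition padic_shells :: "int set \<Rightarrow> 'p::prime_card padic set" where
  "padic_shells K = (\<Union>k\<in>K. sphere 0 (CARD('p) powr k))"

definition shell_powr :: "int set \<Rightarrow> real \<Rightarrow> 'p::prime_card padic \<Rightarrow> real" where
  "shell_powr K s x = indicator (padic_shells K) x * padic_norm x powr s"

lemma shell_powr_nonneg: "0 \<le> shell_powr K s x"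
  by (simp add: shell_powr_def)

lemma shell_powr_borel [measurable]: "shell_powr K s \<in> borel_measurable borel"
  unfolding shell_powr_def padic_shells_def by measurable

lemma shell_powr_cong_norm:
  fixes x y :: "'p::prime_card padic"
  shows "padic_norm x = padic_norm y \<Longrightarrow> shell_powr K s x = shell_powr K s y"
  by (simp add: shell_powr_def padic_shells_def dist_padic_def indicator_def)

lemma shell_powr_mult_powr: "shell_powr K s x * padic_norm x powr t = shell_powr K (s + t) x"
  by (simp add: shell_powr_def powr_add)

lemma shell_powr_powr: "shell_powr K s x powr t = shell_powr K (s * t) x"
  by (simp add: shell_powr_def powr_powr indicator_def)

context padic_haar
begin

lemma has_bochner_integral_shell_powr:
  fixes s :: real
  assumes "finite K"
  shows "has_bochner_integral (units_measure M) (shell_powr K s)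
     ((1 - 1 / CARD('p)) * (\<Sum>k\<in>K. CARD('p) powr (k * (s + 1))))"
proof -
  let ?S = "\<lambda>k :: int. sphere 0 (CARD('p) powr k) :: 'p padic set"
  have "has_bochner_integral (units_measure M) (\<lambda>x. \<Sum>k\<in>K. CARD('p) powr (k * s) * indicator (?S k) x)
      (\<Sum>k\<in>K. CARD('p) powr (k * s) * (CARD('p) powr k * (1 - 1 / CARD('p))))"
    by (intro has_bochner_integral_sum has_bochner_integral_mult_right has_bochner_integral_indicator_sphere)
  moreover have "(\<Sum>k\<in>K. CARD('p) powr (k * s) * indicator (?S k) x) = shell_powr K s x"
    for x :: "'p padic"
  proof -
    have "shell_powr K s x = (\<Sum>k\<in>K. indicator (?S k) x * padic_norm x powr s)"
      unfolding shell_powr_def padic_shells_def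
      by (simp add: indicator_UN_disjoint[OF assms disjoint_family_sphere_padic] sum_distrib_right)
    also have "\<dots> = (\<Sum>k\<in>K. CARD('p) powr (k * s) * indicator (?S k) x)"
      by (intro sum.cong) (auto simp: indicator_def dist_padic_def powr_powr)
    finally show ?thesis ..
  qed
  moreover have "(\<Sum>k\<in>K. CARD('p) powr (k * s) * (CARD('p) powr k * (1 - 1 / CARD('p))))
      = (1 - 1 / CARD('p)) * (\<Sum>k\<in>K. CARD('p) powr (k * (s + 1)))"
    by (simp add: sum_distrib_left powr_add distrib_left mult_ac)
  ultimately show ?thesis by simp
qed

lemma shell_powr_in_Lq: "finite K \<Longrightarrow> shell_powr K s \<in> Lq M q \<theta>" for s :: real
  using has_bochner_integral_shell_powr[THEN integrable.intros]
  by (simp add: Lq_def borel_measurable_units_measure shell_powr_nonneg shell_powr_powr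
      shell_powr_mult_powr)

lemma Lq_norm_shell_powr:
  fixes s q \<theta> :: real
  assumes "finite K"
  shows "Lq_norm M q \<theta> (shell_powr K s)
    = ((1 - 1 / CARD('p)) * (\<Sum>k\<in>K. CARD('p) powr (k * (s * q + \<theta> + 1)))) powr (1 / q)"
  using has_bochner_integral_shell_powr[OF assms, THEN has_bochner_integral_integral_eq]
  by (simp add: Lq_norm_def shell_powr_nonneg shell_powr_powr shell_powr_mult_powr)

lemma ex_shells_Lq_norm_ge:
  "\<exists>K. finite K \<and> card K = N \<and>
     ((1 - 1 / CARD('p)) * N) powr (1 / q) \<le> Lq_norm M q \<theta> (shell_powr K s)"
  if "0 < q" for s q \<theta> :: real
proof -
  define D where "D = s * q + \<theta> + 1"
  define K :: "int set" where "K = (if 0 \<le> D then {0..<int N} else {- int N<..0})"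
  have K: "finite K" "card K = N" by (auto simp: K_def)
  have "0 \<le> k * D" if "k \<in> K" for k :: int
    using that by (auto simp: K_def mult_nonpos_nonpos split: if_splits)
  then have "(\<Sum>k\<in>K. 1) \<le> (\<Sum>k\<in>K. CARD('p) powr (k * D))"
    using prime_card_gt_1[where 'p='p] by (intro sum_mono ge_one_powr_ge_zero) auto
  then have "((1 - 1 / CARD('p)) * N) powr (1 / q) \<le> Lq_norm M q \<theta> (shell_powr K s)"
    unfolding Lq_norm_shell_powr[OF K(1)] D_def[symmetric]
    using K(2) prime_card_gt_1[where 'p='p] \<open>0 < q\<close> by (intro powr_mono2 mult_left_mono) auto
  with K show ?thesis by blast
qed

lemma Lq_norm_shell_powr_critical_le:
  assumes "finite K" "0 < q"
  shows "Lq_norm M q \<theta> (shell_powr K (- (\<theta> + 1) / q)) \<le> card K powr (1 / q)"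
proof -
  have "- (\<theta> + 1) / q * q + \<theta> + 1 = 0" using assms(2) by simp
  then have "Lq_norm M q \<theta> (shell_powr K (- (\<theta> + 1) / q)) = ((1 - 1 / CARD('p)) * card K) powr (1 / q)"
    unfolding Lq_norm_shell_powr[OF assms(1)] by simp
  also have "\<dots> \<le> card K powr (1 / q)"
    using assms prime_card_gt_1[where 'p='p] by (intro powr_mono2) (auto simp: mult_left_le_one_le)
  finally show ?thesis .
qed

end

section \<open>Unboundedness of the operator\<close>

lemma ex_nat_powr_dominates:
  fixes a b c C :: real
  assumes "a < b" "0 < c"
  shows "\<exists>N::nat. 0 < N \<and> C * N powr a < c * N powr b"
proof -
  have "filterlim (\<lambda>N::nat. real N powr (b - a)) at_top sequentially"
    using \<open>a < b\<close> by real_asymp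
  then have "\<forall>\<^sub>F N in sequentially. C / c < real N powr (b - a)"
    by (simp add: filterlim_at_top_dense)
  then obtain N :: nat where N: "0 < N" "C / c < N powr (b - a)"
    using eventually_gt_at_top[of "0::nat"]
    by (metis (mono_tags, lifting) eventually_conj eventually_happens' sequentially_bot)
  then have "C * N powr a < c * (N powr (b - a) * N powr a)"
    using \<open>0 < c\<close> by (simp add: field_simps)
  with N(1) show ?thesis by (auto simp flip: powr_add)
qed

context padic_haar
begin

lemma H_op_ge_sphere:
  assumes "y \<noteq> 0" and integrable: "integrable (units_measure M) (H_integrand lam \<mu> \<nu> f y)"
    and nonneg: "\<And>x. 0 \<le> f x" and lower: "\<And>x. padic_norm x = padic_norm y \<Longrightarrow> c \<le> f x"
  shows "(1 - 1 / CARD('p)) * padic_norm y powr (\<mu> + \<nu> - lam + 1) * c \<le> H_op M lam \<mu> \<nu> f y"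
proof -
  let ?w = "padic_norm y powr (\<mu> + \<nu> - lam) * c" and ?S = "sphere 0 (padic_norm y) :: 'p padic set"
  obtain k :: int where k: "padic_norm y = CARD('p) powr k"
    using \<open>y \<noteq> 0\<close> by (rule padic_norm_eq_powrE)
  have sphere: "has_bochner_integral (units_measure M) (\<lambda>x. ?w * indicator ?S x)
      (?w * (padic_norm y * (1 - 1 / CARD('p))))"
    unfolding k by (intro has_bochner_integral_mult_right has_bochner_integral_indicator_sphere)
  have "?w * indicator ?S x \<le> H_integrand lam \<mu> \<nu> f y x" for x
  proof (cases "padic_norm x = padic_norm y")
    case True
    then have "H_integrand lam \<mu> \<nu> f y x = padic_norm y powr (\<mu> + \<nu> - lam) * f x"
      by (simp add: H_integrand_def powr_add powr_diff)
    then show ?thesis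
      using lower[OF True] True by (simp add: dist_padic_def mult_left_mono)
  next
    case False
    then show ?thesis by (simp add: H_integrand_def nonneg dist_padic_def)
  qed
  then have "?w * (padic_norm y * (1 - 1 / CARD('p))) \<le> H_op M lam \<mu> \<nu> f y"
    unfolding H_op_def has_bochner_integral_integral_eq[OF sphere, symmetric]
    by (intro integral_mono integrable.intros[OF sphere] integrable)
  moreover have "padic_norm y powr (\<mu> + \<nu> - lam + 1) = padic_norm y powr (\<mu> + \<nu> - lam) * padic_norm y"
    by (simp add: powr_add)
  ultimately show ?thesis by (simp add: mult_ac)
qed

lemma H_op_shell_powr_ge:
  assumes "integrable (units_measure M) (H_integrand lam \<mu> \<nu> (shell_powr K s) y)"
  shows "(1 - 1 / CARD('p)) * shell_powr K (s + (\<mu> + \<nu> - lam + 1)) y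
    \<le> \<bar>H_op M lam \<mu> \<nu> (shell_powr K s) y\<bar>"
proof (cases "y = 0")
  case True
  then show ?thesis by (simp add: shell_powr_def)
next
  case False
  have "shell_powr K s y \<le> shell_powr K s x" if "padic_norm x = padic_norm y" for x :: "'p padic"
    by (simp add: shell_powr_cong_norm[OF that])
  then have "(1 - 1 / CARD('p)) * padic_norm y powr (\<mu> + \<nu> - lam + 1) * shell_powr K s y
      \<le> H_op M lam \<mu> \<nu> (shell_powr K s) y"
    by (rule H_op_ge_sphere[OF False assms shell_powr_nonneg])
  also have "(1 - 1 / CARD('p)) * padic_norm y powr (\<mu> + \<nu> - lam + 1) * shell_powr K s y
      = (1 - 1 / CARD('p)) * shell_powr K (s + (\<mu> + \<nu> - lam + 1)) y"
    by (simp add: mult_ac flip: shell_powr_mult_powr)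
  finally show ?thesis by linarith
qed

lemma Lq_norm_H_op_shell_powr_ge:
  assumes "finite K" "0 < r" and image: "H_op M lam \<mu> \<nu> (shell_powr K s) \<in> Lq M r \<beta>"
    and integrable: "AE y in units_measure M.
      integrable (units_measure M) (H_integrand lam \<mu> \<nu> (shell_powr K s) y)"
  shows "(1 - 1 / CARD('p)) * Lq_norm M r \<beta> (shell_powr K (s + (\<mu> + \<nu> - lam + 1)))
    \<le> Lq_norm M r \<beta> (H_op M lam \<mu> \<nu> (shell_powr K s))"
proof -
  let ?c = "1 - 1 / real CARD('p)" and ?g = "shell_powr K (s + (\<mu> + \<nu> - lam + 1)) :: 'p padic \<Rightarrow> real"
  have c: "0 \<le> ?c" using prime_card_gt_1[where 'p='p] by simp
  have "?c * Lq_norm M r \<beta> ?g = Lq_norm M r \<beta> (\<lambda>y. ?c * ?g y)"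
    using c by (simp add: Lq_norm_cmult[OF \<open>0 < r\<close>])
  also have "\<dots> \<le> Lq_norm M r \<beta> (H_op M lam \<mu> \<nu> (shell_powr K s))"
  proof (rule Lq_norm_mono_AE)
    show "AE y in units_measure M. \<bar>?c * ?g y\<bar> \<le> \<bar>H_op M lam \<mu> \<nu> (shell_powr K s) y\<bar>"
      using integrable
      by eventually_elim (use H_op_shell_powr_ge c in \<open>simp add: abs_mult shell_powr_nonneg\<close>)
  qed (use assms in \<open>auto intro: Lq_cmult shell_powr_in_Lq\<close>)
  finally show ?thesis .
qed

lemma not_H_bounded_if_norm_shell_powr_le:
  assumes "0 < r" "e < 1 / r"
    and X: "\<And>K. finite K \<Longrightarrow> shell_powr K s \<in> X"
    and nX_nonneg: "\<And>K. finite K \<Longrightarrow> 0 \<le> nX (shell_powr K s)"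
    and nX_le: "\<And>K. finite K \<Longrightarrow> K \<noteq> {} \<Longrightarrow> nX (shell_powr K s) \<le> card K powr e"
  shows "\<not> H_bounded M lam \<mu> \<nu> X nX (Lq M r \<beta>) (Lq_norm M r \<beta>)"
proof
  let ?c = "1 - 1 / real CARD('p)"
  have c: "0 < ?c" using prime_card_gt_1[where 'p='p] by simp
  assume "H_bounded M lam \<mu> \<nu> X nX (Lq M r \<beta>) (Lq_norm M r \<beta>)"
  then obtain C
    where integrable: "\<And>f. f \<in> X \<Longrightarrow>
        AE y in units_measure M. integrable (units_measure M) (H_integrand lam \<mu> \<nu> f y)"
      and image: "\<And>f. f \<in> X \<Longrightarrow> H_op M lam \<mu> \<nu> f \<in> Lq M r \<beta>"
      and bound: "\<And>f. f \<in> X \<Longrightarrow> Lq_norm M r \<beta> (H_op M lam \<mu> \<nu> f) \<le> C * nX f"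
    unfolding H_bounded_def by blast
  obtain N :: nat where N: "0 < N" "\<bar>C\<bar> * N powr e < ?c * ?c powr (1 / r) * N powr (1 / r)"
    using ex_nat_powr_dominates[OF \<open>e < 1 / r\<close>, of "?c * ?c powr (1 / r)" "\<bar>C\<bar>"] c by auto
  obtain K where K: "finite K" "card K = N"
    and shells: "(?c * N) powr (1 / r) \<le> Lq_norm M r \<beta> (shell_powr K (s + (\<mu> + \<nu> - lam + 1)))"
    using ex_shells_Lq_norm_ge[OF \<open>0 < r\<close>] by blast
  then have "K \<noteq> {}" using N(1) by auto
  have "?c * ?c powr (1 / r) * N powr (1 / r) = ?c * (?c * N) powr (1 / r)"
    using c by (simp add: powr_mult)
  also have "\<dots> \<le> ?c * Lq_norm M r \<beta> (shell_powr K (s + (\<mu> + \<nu> - lam + 1)))"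
    using shells c by (intro mult_left_mono) auto
  also have "\<dots> \<le> Lq_norm M r \<beta> (H_op M lam \<mu> \<nu> (shell_powr K s))"
    using K(1) X by (intro Lq_norm_H_op_shell_powr_ge \<open>0 < r\<close> image integrable)
  also have "\<dots> \<le> C * nX (shell_powr K s)"
    by (intro bound X K(1))
  also have "\<dots> \<le> \<bar>C\<bar> * N powr e"
    using nX_le[OF K(1) \<open>K \<noteq> {}\<close>] nX_nonneg[OF K(1)] K(2) by (intro mult_mono) auto
  finally show False using N(2) by simp
qed

lemma not_H_bounded_Lq:
  assumes "0 < r" "r < q"
  shows "\<not> H_bounded M lam \<mu> \<nu> (Lq M q \<alpha>) (Lq_norm M q \<alpha>) (Lq M r \<beta>) (Lq_norm M r \<beta>)"
proof (rule not_H_bounded_if_norm_shell_powr_le)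
  show "1 / q < 1 / r" using assms by (simp add: divide_strict_left_mono)
qed (use assms in \<open>auto intro: shell_powr_in_Lq Lq_norm_nonneg Lq_norm_shell_powr_critical_le\<close>)

lemma not_H_bounded_Linf:
  assumes "0 < r"
  shows "\<not> H_bounded M lam \<mu> \<nu> (Linf M) (Linf_norm M) (Lq M r \<beta>) (Lq_norm M r \<beta>)"
proof (rule not_H_bounded_if_norm_shell_powr_le)
  fix K :: "int set"
  have measurable: "shell_powr K 0 \<in> borel_measurable (units_measure M)"
    by (intro borel_measurable_units_measure shell_powr_borel)
  moreover have "\<bar>shell_powr K 0 x\<bar> \<le> 1" for x :: "'p padic"
    by (simp add: shell_powr_def indicator_def)
  ultimately show "shell_powr K 0 \<in> Linf M"
    and "finite K \<Longrightarrow> K \<noteq> {} \<Longrightarrow> Linf_norm M (shell_powr K 0) \<le> card K powr 0"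
    by (auto intro: bounded_in_Linf[where c = 1])
  show "0 \<le> Linf_norm M (shell_powr K 0)" using measurable by (rule Linf_norm_nonneg)
qed (use assms in auto)

end

theorem mainTheorem6:
  fixes M :: "'p::prime_card padic measure"
    and q :: ereal
    and r lam \<mu> \<nu> \<alpha> \<beta> :: real
  assumes "is_padic_haar M"
    and "1 \<le> r" and "ereal r < q"
  shows "(q < \<infinity> \<longrightarrow> \<not> H_bounded M lam \<mu> \<nu>
            (Lq M (real_of_ereal q) \<alpha>) (Lq_norm M (real_of_ereal q) \<alpha>) (Lq M r \<beta>) (Lq_norm M r \<beta>))
       \<and> (q = \<infinity> \<longrightarrow> \<not> H_bounded M lam \<mu> \<nu> (Linf M) (Linf_norm M) (Lq M r \<beta>) (Lq_norm M r \<beta>))"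
proof -
  interpret padic_haar M by unfold_locales (fact assms(1))
  have "0 < r" using assms(2) by simp
  show ?thesis
  proof (intro conjI impI)
    assume "q < \<infinity>"
    then have "r < real_of_ereal q" using assms(3) by (cases q) auto
    with \<open>0 < r\<close> show "\<not> H_bounded M lam \<mu> \<nu>
        (Lq M (real_of_ereal q) \<alpha>) (Lq_norm M (real_of_ereal q) \<alpha>) (Lq M r \<beta>) (Lq_norm M r \<beta>)"
      by (rule not_H_bounded_Lq)
  next
    show "\<not> H_bounded M lam \<mu> \<nu> (Linf M) (Linf_norm M) (Lq M r \<beta>) (Lq_norm M r \<beta>)"
      using \<open>0 < r\<close> by (rule not_H_bounded_Linf)
  qed
qed

end
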